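(* Let $X$ be a super-reflexive Banach space, $c\ge1$, and let $U\subset X$ be an arbitrary union of uniformly separated open $c$-quasiconvex sets. If $f\in C^{1,+}(U)$ is Lipschitz, then it can be extended to a Lipschitz function $F\in C^{1,+}(X)$.
   Context: All normed linear spaces are real and $Df$ denotes the Fréchet derivative. For an open subset $U$ of a normed linear space, $C^{1,+}(U)$ is the set of all Fréchet differentiable $f\colon U\to\mathbb R$ such that $Df$ is uniformly continuous on $U$. A metric space $(Z,\rho)$ is $c$-quasiconvex ($c\ge1$) if for each $x,y\in Z$ there is a continuous rectifiable curve $\gamma\colon[0,1]\to Z$ with $\gamma(0)=x$, $\gamma(1)=y$ and length (variation) at most $c\rho(x,y)$; subsets of normed spaces carry the norm metric. A family $\{U_\gamma\}_{\gamma\in\Gamma}$ of subsets of $X$ (with arbitrary index set $\Gamma$) is uniformly separated if there is $\delta_0>0$ such that $\operatorname{dist}(U_\alpha,U_\beta)\ge\delta_0$ for all $\alpha,\beta\in\Gamma$, $\alpha\ne\beta$. A Banach space is super-reflexive if and only if it has an equivalent uniformly smooth norm. *)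

theory Defs
  imports "HOL-Analysis.Analysis"
begin

definition equivalent_norm :: "('a::real_normed_vector \<Rightarrow> real) \<Rightarrow> bool" where
  "equivalent_norm N \<longleftrightarrow>
     (\<forall>x y. N (x + y) \<le> N x + N y) \<and>
     (\<forall>a x. N (a *\<^sub>R x) = \<bar>a\<bar> * N x) \<and>
     (\<exists>m>0. \<exists>M>0. \<forall>x. m * norm x \<le> N x \<and> N x \<le> M * norm x)"

(* The modulus of smoothness
     rho(t) = sup { (N (x + t y) + N (x - t y)) / 2 - 1 | N x = N y = 1 }
   satisfies rho(t) / t --> 0 as t --> 0+. The supremum is unfolded so that the
   zero space, which has no unit vectors, is covered without a real Sup of the
   empty set. *)
definition uniformly_smooth :: "('a::real_vector \<Rightarrow> real) \<Rightarrow> bool" where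
  "uniformly_smooth N \<longleftrightarrow>
     (\<forall>\<epsilon>>0. \<exists>\<delta>>0. \<forall>t. 0 < t \<and> t < \<delta> \<longrightarrow>
        (\<forall>x y. N x = 1 \<and> N y = 1 \<longrightarrow>
           (N (x + t *\<^sub>R y) + N (x - t *\<^sub>R y)) / 2 - 1 \<le> \<epsilon> * t))"

(* Super-reflexivity via Enflo's renorming description: existence of an
   equivalent uniformly smooth norm. *)
definition super_reflexive :: "'a::banach itself \<Rightarrow> bool" where
  "super_reflexive TYPE('a) \<longleftrightarrow>
     (\<exists>N :: 'a \<Rightarrow> real. equivalent_norm N \<and> uniformly_smooth N)"

definition curve_length :: "(real \<Rightarrow> 'a::metric_space) \<Rightarrow> ennreal" where
  "curve_length g =
     (SUP (n, t) \<in> {(n :: nat, t :: nat \<Rightarrow> real).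
                      t 0 = 0 \<and> t n = 1 \<and> (\<forall>i<n. t i \<le> t (Suc i))}.
        ennreal (\<Sum>i<n. dist (g (t i)) (g (t (Suc i)))))"

(* Rectifiability of the curve is implied by the finite bound on its length. *)
definition quasiconvex :: "real \<Rightarrow> 'a::metric_space set \<Rightarrow> bool" where
  "quasiconvex c Z \<longleftrightarrow>
     (\<forall>x\<in>Z. \<forall>y\<in>Z. \<exists>g. path g \<and> path_image g \<subseteq> Z \<and>
        pathstart g = x \<and> pathfinish g = y \<and>
        curve_length g \<le> ennreal (c * dist x y))"

(* dist (U i) (U j) \<ge> d is stated pointwise, i.e. with infinite distance to the
   empty set; setdist would be 0 in that case. *)
definition uniformly_separated :: "'i set \<Rightarrow> ('i \<Rightarrow> 'a::metric_space set) \<Rightarrow> bool" where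
  "uniformly_separated I U \<longleftrightarrow>
     (\<exists>d>0. \<forall>i\<in>I. \<forall>j\<in>I. i \<noteq> j \<longrightarrow> (\<forall>x\<in>U i. \<forall>y\<in>U j. d \<le> dist x y))"

(* Meant for open U, where the derivative D is unique on U. *)
definition C1_plus :: "'a::real_normed_vector set \<Rightarrow> ('a \<Rightarrow> real) set" where
  "C1_plus U = {f. \<exists>D :: 'a \<Rightarrow> 'a \<Rightarrow>\<^sub>L real.
     (\<forall>x\<in>U. (f has_derivative blinfun_apply (D x)) (at x within U)) \<and>
     uniformly_continuous_on U D}"

end

theory Submission
  imports Defs
begin

text \<open>
A Lipschitz function has a uniformly continuous derivative as soon as it is, uniformly in the base
point, both nearly convex and nearly concave at small scales, with errors \<open>o(norm v)\<close> for segments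
in direction \<open>v\<close> (\<open>C1_plus_if_gap_small\<close>). So it suffices to find an extension of \<open>f\<close> with these two
one-sided properties.

On \<open>U\<close>, the pair \<open>(f, D f)\<close> satisfies conditions of Whitney type: \<open>D f\<close> has a bounded modulus of
continuity \<open>\<sigma>\<close>, and \<open>f\<close> deviates from its first-order expansion at \<open>x\<close> by at most
\<open>\<sigma> (norm (x - y)) * norm (x - y)\<close> at \<open>y\<close>. For points in the same quasiconvex piece this follows
by integrating along a short curve; points in different pieces are a definite distance apart, where the
Lipschitz bound suffices (\<open>jet_bounds\<close>).

Super-reflexivity enters through a gauge \<open>\<phi>\<close> that dominates this first-order error, vanishes at the
origin, and is nearly concave at small scales: a primitive of \<open>\<sigma>\<close> composed with a uniformly smooth norm
(\<open>smooth_gauge_exists\<close>). The functions \<open>f y + D f y (x - y) + \<phi> (x - y)\<close> of \<open>x\<close>, for \<open>y\<close> in \<open>U\<close>, lie above the functions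
\<open>f y + D f y (x - y) - \<phi> (x - y)\<close>. The infimum of the former is nearly concave and Lipschitz, and
the latter are nearly convex.

The extension is the largest nearly convex function below that infimum. It is near concavity that
could be lost, and it survives because the class of competitors is invariant under averaging translates
(\<open>envelope_between\<close>). This argument requires only translation-invariant error bounds, so it works for
every modulus \<open>\<sigma>\<close> and in every normed space that carries the gauge.
\<close>

section \<open>Convexity gaps and envelopes\<close>

text \<open>With the endpoints \<open>x = p + (1 - l) v\<close> and \<open>y = p - l v\<close> one has \<open>p = l x + (1 - l) y\<close> and
\<open>v = x - y\<close>, so this is the height of the chord from \<open>x\<close> to \<open>y\<close> above the graph at \<open>p\<close>. Writing it in
terms of \<open>p\<close> and \<open>v\<close> makes a bound that depends only on \<open>l\<close> and \<open>v\<close> visibly invariant under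
translations.\<close>

definition convexity_gap :: "('a::real_vector \<Rightarrow> real) \<Rightarrow> real \<Rightarrow> 'a \<Rightarrow> 'a \<Rightarrow> real" where
  "convexity_gap g l p v = l * g (p + (1 - l) *\<^sub>R v) + (1 - l) * g (p - l *\<^sub>R v) - g p"

text \<open>The class of functions with gap at least \<open>-B\<close> is closed under suprema, convex combinations,
translations and addition of constants. Hence the largest member \<open>E\<close> of that class below \<open>h\<close> inherits
from \<open>h\<close> every one-sided estimate that compares \<open>h\<close> with averages of its translates: the average of
translates of \<open>E\<close>, shifted by the constant, is again in the class and below \<open>h\<close>, hence below \<open>E\<close>.
This is applied to the upper bound on the gap and to the Lipschitz bound.\<close>

lemma envelope_between:
  fixes h :: "'a::real_normed_vector \<Rightarrow> real"
  assumes lip: "L-lipschitz_on UNIV h"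
    and upper: "\<And>l p v. l \<in> {0..1} \<Longrightarrow> convexity_gap h l p v \<le> B l v"
    and g0: "\<And>x. g0 x \<le> h x"
      "\<And>l p v. l \<in> {0..1} \<Longrightarrow> - B l v \<le> convexity_gap g0 l p v"
  obtains E where "L-lipschitz_on UNIV E" "\<And>x. E x \<le> h x"
    "\<And>l p v. l \<in> {0..1} \<Longrightarrow> \<bar>convexity_gap E l p v\<bar> \<le> B l v"
    "\<And>g x. (\<And>x. g x \<le> h x) \<Longrightarrow> (\<And>l p v. l \<in> {0..1} \<Longrightarrow> - B l v \<le> convexity_gap g l p v) \<Longrightarrow> g x \<le> E x"
proof -
  define G where "G = {g. (\<forall>x. g x \<le> h x) \<and> (\<forall>l\<in>{0..1}. \<forall>p v. - B l v \<le> convexity_gap g l p v)}"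
  define E where "E x = (SUP g\<in>G. g x)" for x
  have "g0 \<in> G" using g0 by (auto simp: G_def)
  hence ne: "G \<noteq> {}" by auto
  have bdd: "bdd_above ((\<lambda>g. g x) ` G)" for x
    by (rule bdd_aboveI[where M = "h x"]) (auto simp: G_def)
  have GE: "g x \<le> E x" if "g \<in> G" for g x
    unfolding E_def by (rule cSUP_upper[OF that bdd])
  have Eh: "E x \<le> h x" for x
    unfolding E_def by (rule cSUP_least[OF ne]) (auto simp: G_def)
  have approx: "\<exists>g\<in>G. E x - \<eta> < g x" if "\<eta> > 0" for x \<eta>
    using less_cSUP_iff[OF ne bdd, of "E x - \<eta>" x] that by (auto simp: E_def)
  have lower: "- B l v \<le> convexity_gap E l p v" if l: "l \<in> {0..1}" for l p v
  proof (rule field_le_epsilon)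
    fix \<eta> :: real assume "\<eta> > 0"
    then obtain g where g: "g \<in> G" "E p - \<eta> < g p" using approx by blast
    have "- B l v \<le> convexity_gap g l p v" using g l by (auto simp: G_def)
    moreover have "l * g (p + (1 - l) *\<^sub>R v) \<le> l * E (p + (1 - l) *\<^sub>R v)"
      "(1 - l) * g (p - l *\<^sub>R v) \<le> (1 - l) * E (p - l *\<^sub>R v)"
      using l GE[OF g(1)] by (auto intro!: mult_left_mono)
    ultimately show "- B l v \<le> convexity_gap E l p v + \<eta>" using g(2) by (simp add: convexity_gap_def)
  qed
  have upperE: "convexity_gap E l p v \<le> B l v" if l: "l \<in> {0..1}" for l p v
  proof -
    \<comment> \<open>the averaged translate of \<open>E\<close>, a competitor in the supremum that defines \<open>E\<close>\<close>
    define k where "k q = convexity_gap E l q v + E q - B l v" for q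
    have kh: "k q \<le> h q" for q
    proof -
      have "l * E (q + (1 - l) *\<^sub>R v) \<le> l * h (q + (1 - l) *\<^sub>R v)"
        "(1 - l) * E (q - l *\<^sub>R v) \<le> (1 - l) * h (q - l *\<^sub>R v)"
        using l Eh by (auto intro!: mult_left_mono)
      with upper[OF l, of q v] show ?thesis by (simp add: k_def convexity_gap_def)
    qed
    have kg: "- B m w \<le> convexity_gap k m q w" if m: "m \<in> {0..1}" for m q w
    proof -
      have eq: "convexity_gap k m q w = l * convexity_gap E m (q + (1 - l) *\<^sub>R v) w + (1 - l) * convexity_gap E m (q - l *\<^sub>R v) w"
        unfolding k_def convexity_gap_def by (simp add: algebra_simps)
      have "l * (- B m w) + (1 - l) * (- B m w) \<le> convexity_gap k m q w"
        unfolding eq using lower[OF m] l by (intro add_mono mult_left_mono) auto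
      thus ?thesis by (simp add: algebra_simps)
    qed
    have "k \<in> G" using kh kg by (auto simp: G_def)
    from GE[OF this, of p] show ?thesis by (simp add: k_def)
  qed
  have lipE: "E (x + z) - L * norm z \<le> E x" for x z
  proof -
    have "(\<lambda>x. E (x + z) - L * norm z) \<in> G"
    proof -
      have "E (x + z) - L * norm z \<le> h x" for x
        using lipschitz_onD[OF lip, of "x + z" x] Eh[of "x + z"] by (auto simp: dist_norm)
      moreover have "convexity_gap (\<lambda>x. E (x + z) - L * norm z) l p v = convexity_gap E l (p + z) v" for l p v
        by (simp add: convexity_gap_def algebra_simps)
      ultimately show ?thesis using lower by (auto simp: G_def)
    qed
    from GE[OF this] show ?thesis .
  qed
  have "L-lipschitz_on UNIV E"
  proof (rule lipschitz_onI)
    show "dist (E x) (E y) \<le> L * dist x y" for x y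
      using lipE[of x "y - x"] lipE[of y "x - y"] by (simp add: dist_norm norm_minus_commute)
    show "0 \<le> L" using lip by (rule lipschitz_on_nonneg)
  qed
  moreover have "\<bar>convexity_gap E l p v\<bar> \<le> B l v" if "l \<in> {0..1}" for l p v
    using lower[OF that, of v p] upperE[OF that, of p v] by linarith
  moreover have "g x \<le> E x" if "\<And>x. g x \<le> h x" "\<And>l p v. l \<in> {0..1} \<Longrightarrow> - B l v \<le> convexity_gap g l p v" for g x
    by (rule GE) (use that in \<open>auto simp: G_def\<close>)
  ultimately show thesis using that Eh by metis
qed

section \<open>Differentiability from small convexity gaps\<close>

text \<open>A two-sided gap of size \<open>o(norm v)\<close>, uniformly in the base point, makes the difference quotients
along each ray uniformly Cauchy. The factor \<open>l (1 - l)\<close> is essential: for small \<open>l\<close> the gap divided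
by \<open>l\<close> must still be small. A bound at midpoints only would allow functions that are not
differentiable.\<close>

lemma C1_plus_if_gap_small:
  fixes E :: "'a::real_normed_vector \<Rightarrow> real"
  assumes lip: "L-lipschitz_on UNIV E"
    and gap: "\<And>e. e > 0 \<Longrightarrow> \<exists>d>0. \<forall>l\<in>{0..1}. \<forall>p v. norm v \<le> d \<longrightarrow>
                \<bar>convexity_gap E l p v\<bar> \<le> e * (l * (1 - l) * norm v)"
  shows "E \<in> C1_plus UNIV"
proof -
  \<comment> \<open>\<open>d\<close> is an admissible radius for the tolerance \<open>e\<close>\<close>
  define good where "good e d \<longleftrightarrow> e > 0 \<and> d > 0 \<and> (\<forall>l\<in>{0..1}. \<forall>p v. norm v \<le> d \<longrightarrow>
                \<bar>convexity_gap E l p v\<bar> \<le> e * (l * (1 - l) * norm v))" for e d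
  have ex_good: "\<exists>d. good e d" if "e > 0" for e
    using gap[OF that] that by (auto simp: good_def)
  \<comment> \<open>the gap at \<open>l = 1/2\<close>; it gives additivity and the continuity of the derivative\<close>
  have mid: "\<bar>E ((x + y) /\<^sub>R 2) - (E x + E y) / 2\<bar> \<le> e * norm (x - y) / 4"
    if "good e d" "norm (x - y) \<le> d" for e d x y
  proof -
    have "\<bar>convexity_gap E (1/2) ((x + y) /\<^sub>R 2) (x - y)\<bar> \<le> e * (1/2 * (1 - 1/2) * norm (x - y))"
      using that unfolding good_def by fastforce
    moreover have "(x + y) /\<^sub>R 2 + (1 - 1/2) *\<^sub>R (x - y) = x"
      by (simp add: algebra_simps flip: scaleR_add_left)
    moreover have "(x + y) /\<^sub>R 2 - (1/2) *\<^sub>R (x - y) = y"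
      by (simp add: algebra_simps flip: scaleR_add_left)
    ultimately have "\<bar>(E x + E y) / 2 - E ((x + y) /\<^sub>R 2)\<bar> \<le> e * norm (x - y) / 4"
      unfolding convexity_gap_def by (simp add: add_divide_distrib)
    thus ?thesis by (simp add: abs_minus_commute)
  qed
  \<comment> \<open>the gap at \<open>l = s / t\<close> compares difference quotients at two scales\<close>
  have chord: "\<bar>(E (p + s *\<^sub>R v) - E p) / s - (E (p + t *\<^sub>R v) - E p) / t\<bar> \<le> e * norm v"
    if "good e d" "0 < s" "s \<le> t" "t * norm v \<le> d" for e d p v s t
  proof -
    have t: "t > 0" using that by linarith
    have st: "s / t \<in> {0..1}" using that by auto
    have "\<bar>convexity_gap E (s/t) (p + s *\<^sub>R v) (t *\<^sub>R v)\<bar> \<le> e * (s/t * (1 - s/t) * norm (t *\<^sub>R v))"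
      using that(1,4) st t unfolding good_def by (metis abs_of_pos norm_scaleR)
    also have "\<dots> = e * (s * (1 - s/t) * norm v)" using t by simp
    also have "\<dots> \<le> e * (s * 1 * norm v)"
      using that st t by (intro mult_left_mono mult_right_mono) (auto simp: good_def)
    also have "convexity_gap E (s/t) (p + s *\<^sub>R v) (t *\<^sub>R v)
        = (s/t) * E (p + t *\<^sub>R v) + (1 - s/t) * E p - E (p + s *\<^sub>R v)"
    proof -
      have "p + s *\<^sub>R v + (1 - s/t) *\<^sub>R t *\<^sub>R v = p + t *\<^sub>R v" "p + s *\<^sub>R v - (s/t) *\<^sub>R t *\<^sub>R v = p"
        using t by (simp_all add: algebra_simps)
      thus ?thesis unfolding convexity_gap_def by (simp only:)
    qed
    also have "\<dots> = - s * ((E (p + s *\<^sub>R v) - E p) / s - (E (p + t *\<^sub>R v) - E p) / t)"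
      using t \<open>0 < s\<close> by (simp add: field_simps)
    finally show ?thesis using \<open>0 < s\<close> by (simp add: abs_mult)
  qed
  have "\<exists>a. \<forall>e d t. good e d \<longrightarrow> 0 < t \<longrightarrow> t * norm v \<le> d \<longrightarrow>
      \<bar>E (p + t *\<^sub>R v) - E p - t * a\<bar> \<le> e * (t * norm v)" for p v
  proof -
    define s where "s n = 1 / real (Suc n)" for n
    have s: "s n > 0" for n by (simp add: s_def)
    have s0: "s \<longlonglongrightarrow> 0" unfolding s_def using LIMSEQ_inverse_real_of_nat by (simp add: inverse_eq_divide)
    define X where "X n = (E (p + s n *\<^sub>R v) - E p) / s n" for n
    have ev: "\<forall>\<^sub>F n in sequentially. \<bar>X n - (E (p + t *\<^sub>R v) - E p) / t\<bar> \<le> e * norm v"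
      if "good e d" "0 < t" "t * norm v \<le> d" for e d t
      using order_tendstoD(2)[OF s0 \<open>0 < t\<close>]
      by eventually_elim (use chord[OF that(1) s _ that(3)] in \<open>auto simp: X_def\<close>)
    have "Cauchy X"
    proof (rule metric_CauchyI)
      fix \<epsilon> :: real assume \<epsilon>: "\<epsilon> > 0"
      define e where "e = \<epsilon> / (3 * (norm v + 1))"
      have e: "e > 0" "e * norm v < \<epsilon> / 2"
        using \<epsilon> norm_ge_zero[of v] by (auto simp: e_def field_simps add_pos_nonneg intro!: add_strict_increasing2)
      obtain d where d: "good e d" using ex_good[OF e(1)] by blast
      define t where "t = d / (norm v + 1)"
      have "d > 0" using d by (simp add: good_def)
      hence t: "t > 0" "t * norm v \<le> d" by (auto simp: t_def field_simps add_pos_nonneg)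
      obtain M where M: "\<And>n. n \<ge> M \<Longrightarrow> \<bar>X n - (E (p + t *\<^sub>R v) - E p) / t\<bar> \<le> e * norm v"
        using ev[OF d t] by (auto simp: eventually_sequentially)
      have "dist (X m) (X n) < \<epsilon>" if "m \<ge> M" "n \<ge> M" for m n
        using M[OF that(1)] M[OF that(2)] e(2) by (simp add: dist_real_def)
      thus "\<exists>M. \<forall>m\<ge>M. \<forall>n\<ge>M. dist (X m) (X n) < \<epsilon>" by blast
    qed
    then obtain a where a: "X \<longlonglongrightarrow> a" using Cauchy_convergent convergent_def by blast
    have "\<bar>E (p + t *\<^sub>R v) - E p - t * a\<bar> \<le> e * (t * norm v)"
      if "good e d" "0 < t" "t * norm v \<le> d" for e d t
    proof -
      have "\<bar>a - (E (p + t *\<^sub>R v) - E p) / t\<bar> \<le> e * norm v"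
        by (rule tendsto_upperbound[OF _ ev[OF that]]) (auto intro!: tendsto_intros a)
      hence "t * \<bar>a - (E (p + t *\<^sub>R v) - E p) / t\<bar> \<le> t * (e * norm v)"
        using that(2) by (intro mult_left_mono) auto
      also have "t * \<bar>a - (E (p + t *\<^sub>R v) - E p) / t\<bar> = \<bar>t * (a - (E (p + t *\<^sub>R v) - E p) / t)\<bar>"
        using that(2) by (simp add: abs_mult)
      also have "t * (a - (E (p + t *\<^sub>R v) - E p) / t) = t * a - (E (p + t *\<^sub>R v) - E p)"
        using that(2) by (simp add: field_simps)
      finally show ?thesis by (simp add: abs_minus_commute algebra_simps)
    qed
    thus ?thesis by blast
  qed
  hence "\<exists>D. \<forall>p v e d t. good e d \<longrightarrow> 0 < t \<longrightarrow> t * norm v \<le> d \<longrightarrow>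
      \<bar>E (p + t *\<^sub>R v) - E p - t * D p v\<bar> \<le> e * (t * norm v)"
    by (intro choice allI)
  then obtain D where D: "\<And>p v e d t. good e d \<Longrightarrow> 0 < t \<Longrightarrow> t * norm v \<le> d \<Longrightarrow>
      \<bar>E (p + t *\<^sub>R v) - E p - t * D p v\<bar> \<le> e * (t * norm v)" by blast
  have small: "\<exists>t>0. t * norm u \<le> d \<and> t * norm v \<le> d \<and> t * norm w \<le> d \<and> t * norm z \<le> d"
    if "good e d" for e d and u v w z :: 'a
  proof -
    define C where "C = 1 + norm u + norm v + norm w + norm z"
    have C: "C > 0" "norm u \<le> C" "norm v \<le> C" "norm w \<le> C" "norm z \<le> C"
      unfolding C_def using norm_ge_zero[of u] norm_ge_zero[of v] norm_ge_zero[of w] norm_ge_zero[of z]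
      by linarith+
    have "d > 0" using that by (simp add: good_def)
    have "d / C * norm y \<le> d" if "norm y \<le> C" for y :: 'a
      using that C \<open>d > 0\<close> by (simp add: field_simps)
    thus ?thesis using C \<open>d > 0\<close> by (intro exI[of _ "d / C"]) auto
  qed
  have eqI: "a = b" if "\<And>e. e > 0 \<Longrightarrow> \<bar>a - b\<bar> \<le> e * K" for a b K :: real
  proof (rule ccontr)
    assume "a \<noteq> b"
    hence "\<bar>a - b\<bar> \<le> \<bar>a - b\<bar> / (2 * (\<bar>K\<bar> + 1)) * K" by (intro that) auto
    also have "\<dots> \<le> \<bar>a - b\<bar> / (2 * (\<bar>K\<bar> + 1)) * (\<bar>K\<bar> + 1)" by (intro mult_left_mono) auto
    also have "\<dots> = \<bar>a - b\<bar> / 2" by (simp add: field_simps)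
    finally show False using \<open>a \<noteq> b\<close> by simp
  qed
  \<comment> \<open>compare \<open>p + t (v + w)\<close> with the midpoint of \<open>p + 2 t v\<close> and \<open>p + 2 t w\<close>\<close>
  have add: "D p (v + w) = D p v + D p w" for p v w
  proof (rule eqI[where K = "norm (v + w) + norm v + norm w + norm (v - w) / 2"])
    fix e :: real assume "e > 0"
    then obtain d where d: "good e d" using ex_good by blast
    obtain r where r: "r > 0" "r * norm (v + w) \<le> d" "r * norm v \<le> d" "r * norm w \<le> d" "r * norm (v - w) \<le> d"
      using small[OF d, of "v + w" v w "v - w"] by auto
    define t where "t = r / 2"
    have "d > 0" using d by (simp add: good_def)
    have t: "t > 0" "t * norm (v + w) \<le> d" "2 * t > 0" "(2*t) * norm v \<le> d" "(2*t) * norm w \<le> d"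
        "(2*t) * norm (v - w) \<le> d"
      using r \<open>d > 0\<close> by (auto simp: t_def)
    have m: "((p + (2*t) *\<^sub>R v) + (p + (2*t) *\<^sub>R w)) /\<^sub>R 2 = p + t *\<^sub>R (v + w)"
      by (simp add: algebra_simps flip: scaleR_add_left)
    have df: "norm ((p + (2*t) *\<^sub>R v) - (p + (2*t) *\<^sub>R w)) = (2*t) * norm (v - w)"
      using t by (simp flip: scaleR_diff_right)
    have "\<bar>E (p + t *\<^sub>R (v + w)) - (E (p + (2*t) *\<^sub>R v) + E (p + (2*t) *\<^sub>R w)) / 2\<bar>
        \<le> e * ((2*t) * norm (v - w)) / 4"
      using mid[OF d, of "p + (2*t) *\<^sub>R v" "p + (2*t) *\<^sub>R w"] t unfolding m df by simp
    moreover note D[OF d t(1,2), of p] D[OF d t(3,4), of p] D[OF d t(3,5), of p]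
    ultimately have "\<bar>t * D p (v + w) - t * D p v - t * D p w\<bar>
        \<le> e * (t * norm (v + w)) + e * (t * norm v) + e * (t * norm w) + e * (t * norm (v - w)) / 2"
      by (simp only: mult.assoc mult.left_commute[of _ 2]) argo
    also have "t * D p (v + w) - t * D p v - t * D p w = t * (D p (v + w) - (D p v + D p w))"
      by (simp add: algebra_simps)
    finally have "t * \<bar>D p (v + w) - (D p v + D p w)\<bar>
        \<le> t * (e * (norm (v + w) + norm v + norm w + norm (v - w) / 2))"
      using t(1) by (simp only: abs_mult) (simp add: distrib_left mult_ac)
    thus "\<bar>D p (v + w) - (D p v + D p w)\<bar> \<le> e * (norm (v + w) + norm v + norm w + norm (v - w) / 2)"
      using t(1) by simp
  qed
  have pos: "D p (r *\<^sub>R v) = r * D p v" if "r > 0" for r p v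
  proof (rule eqI[where K = "2 * r * norm v"])
    fix e :: real assume "e > 0"
    then obtain d where d: "good e d" using ex_good by blast
    obtain t where t: "t > 0" "t * norm (r *\<^sub>R v) \<le> d"
      using small[OF d, of "r *\<^sub>R v" 0 0 0] by auto
    have tr: "t * r > 0" "(t * r) * norm v \<le> d" using t that by (auto simp: mult_ac)
    have "\<bar>t * D p (r *\<^sub>R v) - t * r * D p v\<bar> \<le> t * (e * (2 * r * norm v))"
      using D[OF d t, of p] D[OF d tr, of p] that by (simp add: abs_le_iff algebra_simps)
    also have "t * D p (r *\<^sub>R v) - t * r * D p v = t * (D p (r *\<^sub>R v) - r * D p v)"
      by (simp add: algebra_simps)
    finally show "\<bar>D p (r *\<^sub>R v) - r * D p v\<bar> \<le> e * (2 * r * norm v)"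
      using t(1) by (simp add: abs_mult)
  qed
  have D0: "D p 0 = 0" for p using add[of p 0 0] by simp
  have neg: "D p (- v) = - D p v" for p v using add[of p v "- v"] D0 by simp
  have scale: "D p (r *\<^sub>R v) = r * D p v" for p r v
    using pos[of r p v] pos[of "- r" p v] D0[of p] neg[of p "r *\<^sub>R v"]
    by (cases r "0::real" rule: linorder_cases) auto
  have step: "\<bar>E (p + v) - E p - D p v\<bar> \<le> e * norm v" if "good e d" "norm v \<le> d" for e d p v
    using D[OF that(1), of 1 v p] that(2) by simp
  have bound: "\<bar>D p v\<bar> \<le> L * norm v" for p v
  proof (rule field_le_epsilon)
    fix \<eta> :: real assume "\<eta> > 0"
    define e where "e = \<eta> / (norm v + 1)"
    have e: "e > 0" "e * norm v \<le> \<eta>"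
      using \<open>\<eta> > 0\<close> norm_ge_zero[of v] by (auto simp: e_def field_simps add_pos_nonneg)
    obtain d where d: "good e d" using ex_good[OF e(1)] by blast
    obtain t where t: "t > 0" "t * norm v \<le> d" using small[OF d, of v 0 0 0] by auto
    have "\<bar>E (p + t *\<^sub>R v) - E p\<bar> \<le> L * (t * norm v)"
      using lipschitz_onD[OF lip, of "p + t *\<^sub>R v" p] t(1) by (simp add: dist_norm)
    with D[OF d t, of p] have "\<bar>t * D p v\<bar> \<le> t * (L * norm v + e * norm v)"
      by (simp add: abs_le_iff algebra_simps)
    hence "\<bar>D p v\<bar> \<le> L * norm v + e * norm v" using t(1) by (simp add: abs_mult)
    thus "\<bar>D p v\<bar> \<le> L * norm v + \<eta>" using e(2) by linarith
  qed
  have bl: "bounded_linear (D p)" for p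
    by (rule bounded_linear_intro[where K = L]) (auto simp: add scale bound mult.commute)
  define DE where "DE p = Blinfun (D p)" for p
  have DE: "blinfun_apply (DE p) = D p" for p
    unfolding DE_def by (rule bounded_linear_Blinfun_apply[OF bl])
  have "(E has_derivative D p) (at p)" for p
    unfolding has_derivative_at_alt
  proof (intro conjI allI impI bl)
    fix e :: real assume "e > 0"
    then obtain d where d: "good e d" using ex_good by blast
    show "\<exists>d>0. \<forall>y. norm (y - p) < d \<longrightarrow> norm (E y - E p - D p (y - p)) \<le> e * norm (y - p)"
      using step[OF d, of "_ - p" p] d by (intro exI[of _ d]) (auto simp: good_def)
  qed
  moreover have "uniformly_continuous_on UNIV DE"
    unfolding uniformly_continuous_on_def
  proof (intro allI impI)
    fix \<epsilon> :: real assume "\<epsilon> > 0"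
    define e where "e = \<epsilon> / 8"
    have e: "e > 0" using \<open>\<epsilon> > 0\<close> by (simp add: e_def)
    obtain d where d: "good e d" using ex_good[OF e] by blast
    have "d > 0" using d by (simp add: good_def)
    have "dist (DE p) (DE q) < \<epsilon>" if "dist p q < d / 2" for p q
    proof (cases "p = q")
      case False
      define r where "r = norm (p - q)"
      have r: "r > 0" "2 * r \<le> d" using False that by (auto simp: r_def dist_norm)
      \<comment> \<open>the diagonals of the parallelogram \<open>p, q, q + v, p + v\<close> share their midpoint, so the
        increments of \<open>E\<close> by \<open>v\<close> at \<open>p\<close> and at \<open>q\<close> agree up to two midpoint gaps\<close>
      have key: "\<bar>D p v - D q v\<bar> \<le> 4 * e * r" if v: "norm v = r" for v
      proof -
        have n: "norm (p + v - q) \<le> 2 * r" "norm (q + v - p) \<le> 2 * r"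
          using norm_triangle_ineq[of "p - q" v] norm_triangle_ineq[of "q - p" v] v
          by (auto simp: r_def norm_minus_commute algebra_simps)
        have en: "e * norm (p + v - q) \<le> e * (2 * r)" "e * norm (q + v - p) \<le> e * (2 * r)"
          using e n by auto
        have c: "(q + v + p) /\<^sub>R 2 = (p + v + q) /\<^sub>R 2" by (simp add: add_ac)
        have m: "\<bar>E ((p + v + q) /\<^sub>R 2) - (E (p + v) + E q) / 2\<bar> \<le> e * norm (p + v - q) / 4"
          using n r by (intro mid[OF d]) simp
        have m': "\<bar>E ((p + v + q) /\<^sub>R 2) - (E (q + v) + E p) / 2\<bar> \<le> e * norm (q + v - p) / 4"
          unfolding c[symmetric] using n r by (intro mid[OF d]) simp
        have s: "\<bar>E (p + v) - E p - D p v\<bar> \<le> e * r" "\<bar>E (q + v) - E q - D q v\<bar> \<le> e * r"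
          using step[OF d, of v p] step[OF d, of v q] v r by auto
        show ?thesis using m m' en s by argo
      qed
      have "norm (DE p - DE q) \<le> 4 * e"
      proof (rule norm_blinfun_bound)
        fix u
        show "norm (blinfun_apply (DE p - DE q) u) \<le> 4 * e * norm u"
        proof (cases "u = 0")
          case False
          have "\<bar>D p ((r / norm u) *\<^sub>R u) - D q ((r / norm u) *\<^sub>R u)\<bar> \<le> 4 * e * r"
            using r False by (intro key) simp
          hence "\<bar>r / norm u * (D p u - D q u)\<bar> \<le> 4 * e * r" by (simp add: scale algebra_simps)
          hence "r * \<bar>D p u - D q u\<bar> \<le> r * (4 * e * norm u)"
            using r False by (simp only: abs_mult) (simp add: field_simps)
          thus ?thesis using r by (simp add: DE blinfun.diff_left)
        qed auto
      qed (use e in auto)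
      thus ?thesis using \<open>\<epsilon> > 0\<close> by (simp add: dist_norm e_def)
    qed (use \<open>\<epsilon> > 0\<close> in auto)
    thus "\<exists>d>0. \<forall>x\<in>UNIV. \<forall>x'\<in>UNIV. dist x' x < d \<longrightarrow> dist (DE x') (DE x) < \<epsilon>"
      using \<open>d > 0\<close> by (intro exI[of _ "d / 2"]) auto
  qed
  ultimately show ?thesis unfolding C1_plus_def using DE by (auto intro!: exI[of _ DE])
qed

section \<open>Moduli of continuity and smooth gauges\<close>

text \<open>A bounded modulus of continuity on the half-line. Subadditivity is what remains of concavity: it
gives \<open>\<sigma> (2 s) \<le> 2 \<sigma> s\<close> and controls the variation of \<open>\<sigma>\<close> near any point by its values near \<open>0\<close>.\<close>

definition modulus :: "real \<Rightarrow> (real \<Rightarrow> real) \<Rightarrow> bool" where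
  "modulus K \<sigma> \<longleftrightarrow> (\<forall>s\<ge>0. 0 \<le> \<sigma> s \<and> \<sigma> s \<le> K) \<and> mono_on {0..} \<sigma> \<and>
     (\<forall>s\<ge>0. \<forall>t\<ge>0. \<sigma> (s + t) \<le> \<sigma> s + \<sigma> t) \<and> (\<forall>e>0. \<exists>d>0. \<forall>s\<in>{0..d}. \<sigma> s \<le> e)"

text \<open>The best modulus that follows from a family of affine bounds \<open>e + M s\<close>. For subadditivity, take
lines that are nearly optimal at \<open>s\<close> and at \<open>t\<close>; the one with the smaller slope is already below
their sum at \<open>s + t\<close>.\<close>

lemma modulus_Inf_affine:
  fixes A :: "(real \<times> real) set"
  assumes nonneg: "\<And>e M. (e, M) \<in> A \<Longrightarrow> 0 \<le> e \<and> 0 \<le> M"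
    and bound: "(K, 0) \<in> A"
    and small: "\<And>e. e > 0 \<Longrightarrow> \<exists>M. (e, M) \<in> A"
  shows "modulus K (\<lambda>s. INF (e, M)\<in>A. e + M * s)"
proof -
  define \<sigma> where "\<sigma> s = (INF (e, M)\<in>A. e + M * s)" for s
  have ne: "A \<noteq> {}" using bound by auto
  have bdd: "bdd_below ((\<lambda>(e, M). e + M * s) ` A)" if "s \<ge> 0" for s
    using nonneg that by (intro bdd_belowI[where m = 0]) (auto intro!: add_nonneg_nonneg)
  have le: "\<sigma> s \<le> e + M * s" if "(e, M) \<in> A" "s \<ge> 0" for e M s
    unfolding \<sigma>_def using cINF_lower[OF bdd[OF that(2)] that(1)] by simp
  have ge: "b \<le> \<sigma> s" if "\<And>e M. (e, M) \<in> A \<Longrightarrow> b \<le> e + M * s" for b s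
    unfolding \<sigma>_def by (rule cINF_greatest[OF ne]) (use that in auto)
  have mono: "\<sigma> s \<le> \<sigma> t" if "0 \<le> s" "s \<le> t" for s t
  proof (rule ge)
    fix e M assume A: "(e, M) \<in> A"
    have "M * s \<le> M * t" using nonneg[OF A] that by (intro mult_left_mono) auto
    with le[OF A that(1)] show "\<sigma> s \<le> e + M * t" by simp
  qed
  have subadd: "\<sigma> (s + t) \<le> \<sigma> s + \<sigma> t" if "0 \<le> s" "0 \<le> t" for s t
  proof -
    have "\<sigma> (s + t) - \<sigma> t \<le> \<sigma> s"
    proof (rule ge)
      fix e M assume A: "(e, M) \<in> A"
      have "\<sigma> (s + t) - (e + M * s) \<le> \<sigma> t"
      proof (rule ge)
        fix e' M' assume A': "(e', M') \<in> A"
        show "\<sigma> (s + t) - (e + M * s) \<le> e' + M' * t"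
        proof (cases "M \<le> M'")
          case True
          hence "M * t \<le> M' * t" using that by (intro mult_right_mono) auto
          thus ?thesis using le[OF A, of "s + t"] that nonneg[OF A'] by (simp add: algebra_simps)
        next
          case False
          hence "M' * s \<le> M * s" using that by (intro mult_right_mono) auto
          thus ?thesis using le[OF A', of "s + t"] that nonneg[OF A] by (simp add: algebra_simps)
        qed
      qed
      thus "\<sigma> (s + t) - \<sigma> t \<le> e + M * s" by simp
    qed
    thus ?thesis by simp
  qed
  have "\<exists>d>0. \<forall>s\<in>{0..d}. \<sigma> s \<le> e" if "e > 0" for e
  proof -
    obtain M where A: "(e / 2, M) \<in> A" using small[of "e / 2"] \<open>e > 0\<close> by (meson half_gt_zero)
    have M: "M \<ge> 0" using nonneg[OF A] by simp
    have "\<sigma> s \<le> e" if "s \<in> {0..e / (2 * (M + 1))}" for s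
    proof -
      have "M * s \<le> (M + 1) * (e / (2 * (M + 1)))" using that M by (intro mult_mono) auto
      also have "\<dots> = e / 2" using M by (simp add: field_simps)
      finally show ?thesis using le[OF A, of s] that by simp
    qed
    thus ?thesis using M \<open>e > 0\<close> by (intro exI[of _ "e / (2 * (M + 1))"]) auto
  qed
  moreover have "0 \<le> \<sigma> s \<and> \<sigma> s \<le> K" if "s \<ge> 0" for s
    using le[OF bound that] that nonneg by (auto intro!: ge add_nonneg_nonneg)
  ultimately have "modulus K \<sigma>"
    unfolding modulus_def using mono subadd by (auto intro!: mono_onI)
  thus ?thesis unfolding \<sigma>_def .
qed

lemma modulus_primitive:
  assumes "modulus K \<sigma>"
  obtains \<psi> where "\<psi> 0 = 0"
    "\<And>a b. 0 \<le> a \<Longrightarrow> a \<le> b \<Longrightarrow> \<sigma> a * (b - a) \<le> \<psi> b - \<psi> a \<and> \<psi> b - \<psi> a \<le> \<sigma> b * (b - a)"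
proof -
  define \<psi> where "\<psi> t = integral {0..t} \<sigma>" for t
  have mono: "mono_on {0..} \<sigma>" using assms by (simp add: modulus_def)
  have int: "\<sigma> integrable_on {a..b}" if "0 \<le> a" for a b
    by (rule integrable_on_mono_on, rule mono_on_subset[OF mono]) (use that in auto)
  have "\<sigma> a * (b - a) \<le> \<psi> b - \<psi> a \<and> \<psi> b - \<psi> a \<le> \<sigma> b * (b - a)"
    if ab: "0 \<le> a" "a \<le> b" for a b
  proof -
  have "\<psi> b - \<psi> a = integral {a..b} \<sigma>"
    using Henstock_Kurzweil_Integration.integral_combine[OF ab int] by (simp add: \<psi>_def)
  moreover have "integral {a..b} (\<lambda>_. \<sigma> a) \<le> integral {a..b} \<sigma>"
    by (rule integral_le[OF _ int]) (use ab in \<open>auto intro!: mono_onD[OF mono]\<close>)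
  moreover have "integral {a..b} \<sigma> \<le> integral {a..b} (\<lambda>_. \<sigma> b)"
    by (rule integral_le[OF int]) (use ab in \<open>auto intro!: mono_onD[OF mono]\<close>)
  ultimately show ?thesis using ab by (simp add: mult.commute)
  qed
  moreover have "\<psi> 0 = 0" by (simp add: \<psi>_def)
  ultimately show thesis using that by blast
qed

text \<open>The modulus of smoothness controls symmetric second differences only. For a convex function this
suffices for all ratios \<open>l\<close>: when \<open>l \<le> 1/2\<close>, the point \<open>x - l z\<close> lies between \<open>x\<close> and the reflection
\<open>x - (1 - l) z\<close> of the far endpoint, and convexity reduces the gap to \<open>l\<close> times the symmetric second
difference in direction \<open>(1 - l) z\<close>.\<close>

lemma gap_norm_le:
  fixes N :: "'a::real_vector \<Rightarrow> real"
  assumes tri: "\<And>x y. N (x + y) \<le> N x + N y"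
    and hom: "\<And>a x. N (a *\<^sub>R x) = \<bar>a\<bar> * N x"
    and nonneg: "\<And>x. 0 \<le> N x"
    and mid: "\<And>w. N w \<le> N z \<Longrightarrow> N (x + w) + N (x - w) - 2 * N x \<le> e * N w"
    and l: "l \<in> {0..1}"
  shows "convexity_gap N l x z \<le> e * (l * (1 - l) * N z)"
proof -
  have half: "convexity_gap N l x z \<le> e * (l * (1 - l) * N z)"
    if l: "0 \<le> l" "l \<le> 1/2" and mid: "\<And>w. N w \<le> N z \<Longrightarrow> N (x + w) + N (x - w) - 2 * N x \<le> e * N w" for l z
  proof -
    have "(1 - l) *\<^sub>R (x - l *\<^sub>R z) = l *\<^sub>R (x - (1 - l) *\<^sub>R z) + (1 - 2 * l) *\<^sub>R x"
      by (simp add: algebra_simps flip: scaleR_2)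
    hence "(1 - l) * N (x - l *\<^sub>R z) \<le> l * N (x - (1 - l) *\<^sub>R z) + (1 - 2 * l) * N x"
      using tri[of "l *\<^sub>R (x - (1 - l) *\<^sub>R z)" "(1 - 2 * l) *\<^sub>R x"] hom[of "1 - l" "x - l *\<^sub>R z"] l
      by (simp add: hom)
    hence "convexity_gap N l x z \<le> l * (N (x + (1 - l) *\<^sub>R z) + N (x - (1 - l) *\<^sub>R z) - 2 * N x)"
      by (simp add: convexity_gap_def algebra_simps)
    also have "\<dots> \<le> l * (e * N ((1 - l) *\<^sub>R z))"
      using l nonneg[of z] by (intro mult_left_mono mid) (auto simp: hom intro: mult_left_le_one_le)
    also have "\<dots> = e * (l * (1 - l) * N z)" using l by (simp add: hom)
    finally show ?thesis .
  qed
  have N_minus: "N (- z) = N z" using hom[of "-1" z] by simp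
  show ?thesis
  proof (cases "l \<le> 1/2")
    case True
    thus ?thesis using l mid by (intro half) auto
  next
    case False
    have "convexity_gap N (1 - l) x (- z) \<le> e * ((1 - l) * (1 - (1 - l)) * N (- z))"
      using False l mid by (intro half) (auto simp: N_minus)
    moreover have "convexity_gap N (1 - l) x (- z) = convexity_gap N l x z" by (simp add: convexity_gap_def)
    ultimately show ?thesis by (simp add: N_minus mult_ac)
  qed
qed

text \<open>By homogeneity, uniform smoothness is an estimate at every \<open>x\<close>, with increments \<open>z\<close> that are small
relative to \<open>x\<close>. For increments that are not small, the triangle inequality gives the constant \<open>2\<close>.
The norm is scaled so that it dominates the given one.\<close>

lemma uniformly_smooth_gap:
  fixes N0 :: "'a::real_normed_vector \<Rightarrow> real"
  assumes eq: "equivalent_norm N0" and us: "uniformly_smooth N0"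
  obtains N :: "'a \<Rightarrow> real" and C where
    "\<And>x y. N (x + y) \<le> N x + N y" "\<And>a x. N (a *\<^sub>R x) = \<bar>a\<bar> * N x"
    "C > 0" "\<And>x. norm x \<le> N x" "\<And>x. N x \<le> C * norm x"
    "\<And>e. e > 0 \<Longrightarrow> \<exists>d>0. \<forall>x z. N z \<le> d * N x \<longrightarrow> (\<forall>l\<in>{0..1}. convexity_gap N l x z \<le> e * (l * (1 - l) * N z))"
    "\<And>x z l. l \<in> {0..1} \<Longrightarrow> convexity_gap N l x z \<le> 2 * (l * (1 - l) * N z)"
proof -
  obtain m M where mM: "m > 0" "M > 0" "\<And>x. m * norm x \<le> N0 x" "\<And>x. N0 x \<le> M * norm x"
    using eq by (auto simp: equivalent_norm_def)
  define N where "N x = N0 x / m" for x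
  have tri: "N (x + y) \<le> N x + N y" for x y
  proof -
    have "N0 (x + y) \<le> N0 x + N0 y" using eq by (simp add: equivalent_norm_def)
    thus ?thesis using mM(1) by (simp add: N_def field_simps)
  qed
  have hom: "N (a *\<^sub>R x) = \<bar>a\<bar> * N x" for a x
    using eq by (simp add: equivalent_norm_def N_def)
  have low: "norm x \<le> N x" for x using mM(1) mM(3)[of x] by (simp add: N_def field_simps)
  have up: "N x \<le> M / m * norm x" for x using mM(1) mM(4)[of x] by (simp add: N_def field_simps)
  have nonneg: "0 \<le> N x" for x using low[of x] norm_ge_zero[of x] by linarith
  have triv: "N (x + w) + N (x - w) - 2 * N x \<le> 2 * N w" for x w
    using tri[of x w] tri[of x "- w"] hom[of "-1" w] by simp
  have mid: "\<exists>d>0. \<forall>x z. N z \<le> d * N x \<longrightarrow> N (x + z) + N (x - z) - 2 * N x \<le> e * N z"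
    if "e > 0" for e
  proof -
    have "e / 2 > 0" using that by simp
    then obtain d where d: "d > 0" "\<And>t x y. 0 < t \<Longrightarrow> t < d \<Longrightarrow> N0 x = 1 \<Longrightarrow> N0 y = 1 \<Longrightarrow>
        (N0 (x + t *\<^sub>R y) + N0 (x - t *\<^sub>R y)) / 2 - 1 \<le> e / 2 * t"
      using us unfolding uniformly_smooth_def by meson
    have "N (x + z) + N (x - z) - 2 * N x \<le> e * N z" if le: "N z \<le> d / 2 * N x" for x z
    proof (cases "z = 0")
      case False
      have z: "N0 z > 0" using mM(1) mM(3)[of z] False
        by (meson less_le_trans mult_pos_pos zero_less_norm_iff)
      have le': "N0 z \<le> d / 2 * N0 x" using le mM(1) by (simp add: N_def field_simps)
      with z have x: "N0 x > 0" using d(1) by (metis less_le_trans zero_less_mult_pos half_gt_zero)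
      define t where "t = N0 z / N0 x"
      have t: "t > 0" "t < d" using x z d(1) le' by (auto simp: t_def field_simps)
      have hom0: "N0 (a *\<^sub>R y) = \<bar>a\<bar> * N0 y" for a y using eq by (simp add: equivalent_norm_def)
      have "(N0 (x /\<^sub>R N0 x + t *\<^sub>R (z /\<^sub>R N0 z)) + N0 (x /\<^sub>R N0 x - t *\<^sub>R (z /\<^sub>R N0 z))) / 2 - 1 \<le> e / 2 * t"
        using x z by (intro d(2) t) (auto simp: hom0)
      moreover have "x /\<^sub>R N0 x + t *\<^sub>R (z /\<^sub>R N0 z) = (x + z) /\<^sub>R N0 x"
        "x /\<^sub>R N0 x - t *\<^sub>R (z /\<^sub>R N0 z) = (x - z) /\<^sub>R N0 x"
        using x z by (simp_all add: t_def algebra_simps inverse_eq_divide)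
      ultimately have "(N0 ((x + z) /\<^sub>R N0 x) + N0 ((x - z) /\<^sub>R N0 x)) / 2 - 1 \<le> e / 2 * t"
        by (simp only:)
      hence "N0 (x + z) + N0 (x - z) - 2 * N0 x \<le> e * N0 z"
      proof -
        assume "(N0 ((x + z) /\<^sub>R N0 x) + N0 ((x - z) /\<^sub>R N0 x)) / 2 - 1 \<le> e / 2 * t"
        moreover have "(N0 ((x + z) /\<^sub>R N0 x) + N0 ((x - z) /\<^sub>R N0 x)) / 2 - 1
            = (N0 (x + z) + N0 (x - z) - 2 * N0 x) / (2 * N0 x)"
          using x by (simp only: hom0) (simp add: divide_simps)
        moreover have "e / 2 * t = e * N0 z / (2 * N0 x)" by (simp add: t_def)
        ultimately have "(N0 (x + z) + N0 (x - z) - 2 * N0 x) / (2 * N0 x) \<le> e * N0 z / (2 * N0 x)"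
          by (simp only:)
        thus ?thesis using x unfolding divide_le_cancel by simp
      qed
      hence "(N0 (x + z) + N0 (x - z) - 2 * N0 x) / m \<le> e * N0 z / m"
        using mM(1) by (intro divide_right_mono) auto
      thus ?thesis by (simp add: N_def add_divide_distrib diff_divide_distrib)
    qed (use hom[of 0 0] in simp)
    thus ?thesis using d(1) by (intro exI[of _ "d / 2"]) auto
  qed
  have "\<exists>d>0. \<forall>x z. N z \<le> d * N x \<longrightarrow> (\<forall>l\<in>{0..1}. convexity_gap N l x z \<le> e * (l * (1 - l) * N z))"
    if e: "e > 0" for e
  proof -
    obtain d where d: "d > 0" "\<And>x z. N z \<le> d * N x \<Longrightarrow> N (x + z) + N (x - z) - 2 * N x \<le> e * N z"
      using mid[OF e] by blast
    have "convexity_gap N l x z \<le> e * (l * (1 - l) * N z)" if "N z \<le> d * N x" "l \<in> {0..1}" for l x z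
      by (rule gap_norm_le[OF tri hom nonneg]) (use that d(2) in auto)
    thus ?thesis using d(1) by blast
  qed
  moreover have "convexity_gap N l x z \<le> 2 * (l * (1 - l) * N z)" if "l \<in> {0..1}" for l x z
    by (rule gap_norm_le[OF tri hom nonneg]) (use that triv in auto)
  moreover have "M / m > 0" using mM by simp
  ultimately show thesis using that[of N "M / m"] tri hom low up by blast
qed

text \<open>A function that dominates the first-order error \<open>norm w * \<sigma> (norm w)\<close>, vanishes at the origin, and is
as smooth from above as the extension has to be.\<close>

definition smooth_gauge :: "real \<Rightarrow> (real \<Rightarrow> real) \<Rightarrow> ('a::real_normed_vector \<Rightarrow> real) \<Rightarrow> bool" where
  "smooth_gauge P \<sigma> \<phi> \<longleftrightarrow> P-lipschitz_on UNIV \<phi> \<and> \<phi> 0 = 0 \<and> (\<forall>w. norm w * \<sigma> (norm w) \<le> \<phi> w) \<and>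
     (\<forall>e>0. \<exists>d>0. \<forall>l\<in>{0..1}. \<forall>p v. norm v \<le> d \<longrightarrow> convexity_gap \<phi> l p v \<le> e * (l * (1 - l) * norm v))"

text \<open>The gauge is \<open>4 \<psi> (N x)\<close>, where \<open>\<psi>\<close> is a primitive of the modulus and \<open>N\<close> the smooth norm. The norm is
not differentiable at \<open>0\<close> and its smoothness degenerates near \<open>0\<close>, but there the slope \<open>\<sigma> (N x)\<close> of
\<open>\<psi>\<close> is small. So the gap of \<open>\<psi> \<circ> N\<close> is at most \<open>\<sigma> (N p)\<close> times the gap of \<open>N\<close>, plus an error from the
variation of \<open>\<sigma>\<close>. The first term is small because of the smoothness of \<open>N\<close> if \<open>N v\<close> is small compared
with \<open>N p\<close>, and because of the factor \<open>\<sigma> (N p)\<close> otherwise.\<close>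

lemma smooth_gauge_exists:
  fixes N0 :: "'a::real_normed_vector \<Rightarrow> real"
  assumes "equivalent_norm N0" "uniformly_smooth N0" and mod: "modulus K \<sigma>"
  shows "\<exists>P (\<phi> :: 'a \<Rightarrow> real). smooth_gauge P \<sigma> \<phi>"
proof -
  obtain N :: "'a \<Rightarrow> real" and C where tri: "\<And>x y. N (x + y) \<le> N x + N y"
    and hom: "\<And>a x. N (a *\<^sub>R x) = \<bar>a\<bar> * N x"
    and C: "C > 0" and low: "\<And>x. norm x \<le> N x" and up: "\<And>x. N x \<le> C * norm x"
    and sm: "\<And>e. e > 0 \<Longrightarrow> \<exists>d>0. \<forall>x z. N z \<le> d * N x \<longrightarrow> (\<forall>l\<in>{0..1}. convexity_gap N l x z \<le> e * (l * (1 - l) * N z))"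
    and triv: "\<And>x z l. l \<in> {0..1} \<Longrightarrow> convexity_gap N l x z \<le> 2 * (l * (1 - l) * N z)"
    using uniformly_smooth_gap[OF assms(1,2)] by metis
  obtain \<psi> where \<psi>0: "\<psi> 0 = 0"
    and \<psi>: "\<And>a b. 0 \<le> a \<Longrightarrow> a \<le> b \<Longrightarrow> \<sigma> a * (b - a) \<le> \<psi> b - \<psi> a \<and> \<psi> b - \<psi> a \<le> \<sigma> b * (b - a)"
    using modulus_primitive[OF mod] by metis
  have nonneg: "0 \<le> N x" for x using low[of x] norm_ge_zero[of x] by linarith
  have N0: "N 0 = 0" using hom[of 0 0] by simp
  have \<sigma>: "0 \<le> \<sigma> s" "\<sigma> s \<le> K" if "s \<ge> 0" for s using mod that by (auto simp: modulus_def)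
  have K: "K \<ge> 0" using \<sigma>[of 0] by simp
  have mono: "\<sigma> s \<le> \<sigma> t" if "0 \<le> s" "s \<le> t" for s t
    using mod that by (auto simp: modulus_def intro: mono_onD)
  have sub: "\<sigma> (s + t) \<le> \<sigma> s + \<sigma> t" if "0 \<le> s" "0 \<le> t" for s t
    using mod that by (auto simp: modulus_def)
  have N_diff: "\<bar>N x - N y\<bar> \<le> N (x - y)" for x y
    using tri[of "x - y" y] tri[of "y - x" x] hom[of "-1" "x - y"] by simp
  define \<phi> where "\<phi> x = 4 * \<psi> (N x)" for x
  have growth: "norm w * \<sigma> (norm w) \<le> \<phi> w" for w
  proof -
    have "norm w * \<sigma> (norm w) \<le> N w * \<sigma> (N w)"
      using low[of w] nonneg[of w] \<sigma> by (intro mult_mono mono) auto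
    also have "\<sigma> (N w) \<le> 2 * \<sigma> (N w / 2)" using sub[of "N w / 2" "N w / 2"] nonneg[of w] by simp
    hence "N w * \<sigma> (N w) \<le> 4 * (\<sigma> (N w / 2) * (N w - N w / 2))"
      using mult_left_mono[OF _ nonneg[of w]] by (fastforce simp: algebra_simps)
    also have "\<sigma> (N w / 2) * (N w - N w / 2) \<le> \<psi> (N w) - \<psi> (N w / 2)"
      using \<psi>[of "N w / 2" "N w"] nonneg[of w] by simp
    finally have "norm w * \<sigma> (norm w) \<le> 4 * (\<psi> (N w) - \<psi> (N w / 2))" by simp
    moreover have "0 \<le> \<sigma> 0 * (N w / 2)" using \<sigma>(1)[of 0] nonneg[of w] by simp
    hence "0 \<le> \<psi> (N w / 2)" using \<psi>[of 0 "N w / 2"] \<psi>0 nonneg[of w] by simp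
    ultimately show ?thesis by (simp add: \<phi>_def)
  qed
  have \<psi>lip: "\<bar>\<psi> a - \<psi> b\<bar> \<le> K * \<bar>a - b\<bar>" if "0 \<le> a" "0 \<le> b" for a b
    using that
  proof (induction a b rule: linorder_wlog)
    case (le a b)
    have "0 \<le> \<sigma> a * (b - a)" "\<sigma> b * (b - a) \<le> K * (b - a)"
      using le \<sigma> by (auto intro!: mult_right_mono)
    thus ?case using \<psi>[of a b] le by (simp add: abs_minus_commute)
  next
    case (sym a b)
    thus ?case by (simp add: abs_minus_commute)
  qed
  have lip: "(4 * (K * C))-lipschitz_on UNIV \<phi>"
  proof (rule lipschitz_onI)
    fix x y
    have "\<bar>\<psi> (N x) - \<psi> (N y)\<bar> \<le> K * \<bar>N x - N y\<bar>" by (intro \<psi>lip nonneg)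
    also have "\<dots> \<le> K * (C * norm (x - y))"
      using N_diff[of x y] up[of "x - y"] K by (intro mult_left_mono) auto
    finally show "dist (\<phi> x) (\<phi> y) \<le> 4 * (K * C) * dist x y"
      by (simp add: \<phi>_def dist_real_def dist_norm)
  qed (use K C in auto)
  \<comment> \<open>the line through \<open>(t, \<psi> t)\<close> with slope \<open>\<sigma> t\<close> bounds \<open>\<psi>\<close> from above up to an error of small order\<close>
  have super: "\<psi> a \<le> \<psi> t + \<sigma> t * (a - t) + \<sigma> h * h" if "0 \<le> a" "0 \<le> t" "\<bar>a - t\<bar> \<le> h" for a t h
  proof (cases "a \<le> t")
    case True
    have "\<sigma> t \<le> \<sigma> a + \<sigma> (t - a)" using sub[of a "t - a"] True that by simp
    also have "\<sigma> (t - a) \<le> \<sigma> h" using True that by (intro mono) auto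
    finally have "\<sigma> t * (t - a) \<le> (\<sigma> a + \<sigma> h) * (t - a)" using True by (intro mult_right_mono) auto
    also have "\<sigma> h * (t - a) \<le> \<sigma> h * h" using that True \<sigma>[of h] by (intro mult_left_mono) auto
    hence "(\<sigma> a + \<sigma> h) * (t - a) \<le> \<sigma> a * (t - a) + \<sigma> h * h" by (simp add: algebra_simps)
    finally show ?thesis using \<psi>[of a t] True that by (simp add: algebra_simps)
  next
    case False
    have "\<sigma> a \<le> \<sigma> t + \<sigma> (a - t)" using sub[of t "a - t"] False that by simp
    also have "\<sigma> (a - t) \<le> \<sigma> h" using False that by (intro mono) auto
    finally have "\<sigma> a * (a - t) \<le> (\<sigma> t + \<sigma> h) * (a - t)" using False by (intro mult_right_mono) auto
    also have "\<sigma> h * (a - t) \<le> \<sigma> h * h" using that False \<sigma>[of h] by (intro mult_left_mono) auto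
    hence "(\<sigma> t + \<sigma> h) * (a - t) \<le> \<sigma> t * (a - t) + \<sigma> h * h" by (simp add: algebra_simps)
    finally show ?thesis using \<psi>[of t a] False that by (simp add: algebra_simps)
  qed
  have main: "convexity_gap \<phi> l p v \<le> 4 * (\<sigma> (N p) * convexity_gap N l p v + 2 * (l * (1 - l) * (\<sigma> (N v) * N v)))"
    if l: "l \<in> {0..1}" for l p v
  proof -
    define a where "a = N (p + (1 - l) *\<^sub>R v)"
    define b where "b = N (p - l *\<^sub>R v)"
    have d: "\<bar>a - N p\<bar> \<le> (1 - l) * N v" "\<bar>b - N p\<bar> \<le> l * N v"
      using N_diff[of "p + (1 - l) *\<^sub>R v" p] N_diff[of "p - l *\<^sub>R v" p] l hom[of "- l" v]
      by (simp_all add: a_def b_def hom)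
    have le: "\<sigma> (s * N v) * (s * N v) \<le> \<sigma> (N v) * (s * N v)" if "0 \<le> s" "s \<le> 1" for s
      using that nonneg[of v] by (intro mult_right_mono mono) (auto intro: mult_left_le_one_le)
    have "\<psi> a \<le> \<psi> (N p) + \<sigma> (N p) * (a - N p) + \<sigma> (N v) * ((1 - l) * N v)"
      using super[OF _ nonneg d(1)] nonneg le[of "1 - l"] l by (fastforce simp: a_def)
    hence 1: "l * \<psi> a \<le> l * (\<psi> (N p) + \<sigma> (N p) * (a - N p) + \<sigma> (N v) * ((1 - l) * N v))"
      using l by (intro mult_left_mono) auto
    have "\<psi> b \<le> \<psi> (N p) + \<sigma> (N p) * (b - N p) + \<sigma> (N v) * (l * N v)"
      using super[OF _ nonneg d(2)] nonneg le[of l] l by (fastforce simp: b_def)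
    hence 2: "(1 - l) * \<psi> b \<le> (1 - l) * (\<psi> (N p) + \<sigma> (N p) * (b - N p) + \<sigma> (N v) * (l * N v))"
      using l by (intro mult_left_mono) auto
    show ?thesis using 1 2 unfolding convexity_gap_def \<phi>_def a_def[symmetric] b_def[symmetric]
      by (simp add: algebra_simps)
  qed
  have "\<exists>d>0. \<forall>l\<in>{0..1}. \<forall>p v. norm v \<le> d \<longrightarrow> convexity_gap \<phi> l p v \<le> e * (l * (1 - l) * norm v)"
    if "e > 0" for e
  proof -
    \<comment> \<open>the factor \<open>4\<close> is that of the gauge, and \<open>N v \<le> C * norm v\<close>\<close>
    define \<eta> where "\<eta> = e / (4 * C)"
    have \<eta>: "\<eta> > 0" using that C by (simp add: \<eta>_def)
    have "\<eta> / (2 * (K + 1)) > 0" using \<eta> K by simp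
    from sm[OF this] obtain \<delta> where \<delta>: "\<delta> > 0" "\<And>x z l. N z \<le> \<delta> * N x \<Longrightarrow> l \<in> {0..1} \<Longrightarrow>
        convexity_gap N l x z \<le> \<eta> / (2 * (K + 1)) * (l * (1 - l) * N z)" by blast
    have "\<eta> / 4 > 0" using \<eta> by simp
    then obtain r where r: "r > 0" "\<And>s. 0 \<le> s \<Longrightarrow> s \<le> r \<Longrightarrow> \<sigma> s \<le> \<eta> / 4"
      using mod unfolding modulus_def by (meson atLeastAtMost_iff)
    define d where "d = min r (\<delta> * r) / C"
    have "convexity_gap \<phi> l p v \<le> e * (l * (1 - l) * norm v)" if l: "l \<in> {0..1}" and v: "norm v \<le> d" for l p v
    proof -
      define k where "k = l * (1 - l) * N v"
      have k: "k \<ge> 0" using l nonneg[of v] by (simp add: k_def)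
      have "N v \<le> C * d" using up[of v] v C by (meson mult_left_mono less_imp_le order_trans)
      hence Nv: "N v \<le> r" "N v \<le> \<delta> * r" using C by (auto simp: d_def)
      have "\<sigma> (N p) * convexity_gap N l p v \<le> \<eta> / 2 * k"
      proof (cases "N v \<le> \<delta> * N p")
        case True
        have "\<sigma> (N p) * convexity_gap N l p v \<le> \<sigma> (N p) * (\<eta> / (2 * (K + 1)) * k)"
          unfolding k_def using True l nonneg[of p] by (intro mult_left_mono \<delta>(2) \<sigma>)
        also have "\<dots> \<le> (K + 1) * (\<eta> / (2 * (K + 1)) * k)"
          using \<sigma>[of "N p"] nonneg[of p] K k \<eta> by (intro mult_right_mono) auto
        also have "\<dots> = \<eta> / 2 * k" using K by (simp add: field_simps)
        finally show ?thesis .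
      next
        case False
        hence "\<delta> * N p \<le> \<delta> * r" using Nv by linarith
        hence "N p \<le> r" using \<delta>(1) by simp
        have "\<sigma> (N p) * convexity_gap N l p v \<le> \<sigma> (N p) * (2 * k)"
          unfolding k_def using l nonneg[of p] by (intro mult_left_mono triv \<sigma>)
        also have "\<dots> \<le> \<eta> / 4 * (2 * k)"
          using k r(2)[OF nonneg \<open>N p \<le> r\<close>] by (intro mult_right_mono) auto
        finally show ?thesis by simp
      qed
      moreover have "\<sigma> (N v) * k \<le> \<eta> / 4 * k"
        using k r(2)[OF nonneg Nv(1)] by (intro mult_right_mono) auto
      ultimately have "convexity_gap \<phi> l p v \<le> 4 * (\<eta> * k)"
        using main[OF l, of p v] by (simp add: k_def algebra_simps)
      also have "\<dots> \<le> 4 * (\<eta> * (l * (1 - l) * (C * norm v)))"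
        unfolding k_def using \<eta> l up[of v] by (intro mult_left_mono) auto
      also have "\<dots> = e * (l * (1 - l) * norm v)" using C by (simp add: \<eta>_def field_simps)
      finally show ?thesis .
    qed
    moreover have "d > 0" using r \<delta> C by (simp add: d_def)
    ultimately show ?thesis by blast
  qed
  moreover have "\<phi> 0 = 0" using \<psi>0 by (simp add: \<phi>_def N0)
  ultimately have "smooth_gauge (4 * (K * C)) \<sigma> \<phi>"
    unfolding smooth_gauge_def using growth lip by blast
  thus ?thesis by blast
qed

section \<open>First-order estimates on quasiconvex sets\<close>

lemma curve_length_sum_le:
  assumes "curve_length g \<le> ennreal len" "len \<ge> 0"
    and "t 0 = 0" "t n = 1" "\<And>i. i < n \<Longrightarrow> t i \<le> t (Suc i)"
  shows "(\<Sum>i<n. dist (g (t i)) (g (t (Suc i)))) \<le> len"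
proof -
  have "ennreal (\<Sum>i<n. dist (g (t i)) (g (t (Suc i)))) \<le> curve_length g"
    unfolding curve_length_def
    using assms(3-5) by (intro SUP_upper2[of "(n, t)"]) auto
  also note assms(1)
  finally show ?thesis using assms(2) by simp
qed

lemma dist_pathstart_le_curve_length:
  assumes "curve_length g \<le> ennreal len" "len \<ge> 0" "s \<in> {0..1}"
  shows "dist (g 0) (g s) \<le> len"
proof -
  define t where "t i = (if i = 0 then 0 else if i = Suc 0 then s else 1)" for i :: nat
  have "(\<Sum>i<2. dist (g (t i)) (g (t (Suc i)))) \<le> len"
    by (rule curve_length_sum_le[OF assms(1,2)]) (use assms(3) in \<open>auto simp: t_def\<close>)
  thus ?thesis by (simp add: t_def numeral_2_eq_2) (smt (verit) zero_le_dist)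
qed

text \<open>The mean value inequality along a curve. Subtracting the linear map \<open>D0\<close> leaves a function whose
derivative is at most \<open>e\<close> near the curve; its increments over a fine partition, whose consecutive
points lie in balls inside \<open>V\<close>, add up to at most \<open>e\<close> times the length.\<close>

lemma first_order_remainder_along_curve:
  fixes f :: "'a::real_normed_vector \<Rightarrow> real" and D :: "'a \<Rightarrow> 'a \<Rightarrow>\<^sub>L real"
  assumes V: "open V" and der: "\<And>z. z \<in> V \<Longrightarrow> (f has_derivative blinfun_apply (D z)) (at z)"
    and g: "path g" "path_image g \<subseteq> V" "curve_length g \<le> ennreal len" "len \<ge> 0"
    and e: "\<And>z. z \<in> V \<Longrightarrow> dist (pathstart g) z \<le> len \<Longrightarrow> norm (D z - D0) \<le> e"
  shows "\<bar>f (pathfinish g) - f (pathstart g) - D0 (pathfinish g - pathstart g)\<bar> \<le> e * len"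
proof -
  define h where "h z = f z - D0 z" for z
  have "compact (path_image g)" using g(1) by (rule compact_path_image)
  then obtain r where r: "r > 0" "(\<Union>z\<in>path_image g. ball z r) \<subseteq> V"
    using compact_subset_open_imp_ball_epsilon_subset[OF _ V g(2)] by blast
  have "uniformly_continuous_on {0..1} g"
    using g(1) unfolding path_def by (intro compact_uniformly_continuous) auto
  then obtain d where d: "d > 0" "\<And>s t. s \<in> {0..1} \<Longrightarrow> t \<in> {0..1} \<Longrightarrow> dist t s < d \<Longrightarrow> dist (g t) (g s) < r"
    using r(1) unfolding uniformly_continuous_on_def by metis
  obtain n where n: "n > 0" "1 / real n < d"
    using d(1) by (metis nat_approx_posE zero_less_Suc)
  define t where "t i = real i / real n" for i
  have t: "t i \<in> {0..1}" if "i \<le> n" for i using that n by (simp add: t_def)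
  have mem: "g s \<in> V" "dist (g 0) (g s) \<le> len" if "s \<in> {0..1}" for s
    using g that dist_pathstart_le_curve_length[OF g(3,4) that] by (auto simp: path_image_def)
  have e0: "e \<ge> 0"
    using e[of "g 0"] mem[of 0] g(4) norm_ge_zero order_trans unfolding pathstart_def
    by (metis atLeastAtMost_iff dist_self order_refl zero_le_one)
  have step: "\<bar>h (g (t (Suc i))) - h (g (t i))\<bar> \<le> e * dist (g (t i)) (g (t (Suc i)))" if "i < n" for i
  proof -
    \<comment> \<open>convex, so it contains the segment between consecutive points; the second ball is where
      the bound on the derivative applies\<close>
    define S where "S = ball (g (t i)) r \<inter> cball (g 0) len"
    have ti: "t i \<in> {0..1}" "t (Suc i) \<in> {0..1}" using that t[of i] t[of "Suc i"] by auto
    have "dist (t (Suc i)) (t i) = 1 / real n" using n by (simp add: t_def dist_real_def field_simps)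
    hence "dist (g (t (Suc i))) (g (t i)) < r" using d(2)[OF ti] n(2) by simp
    hence S: "g (t i) \<in> S" "g (t (Suc i)) \<in> S"
      using r(1) mem[OF ti(1)] mem[OF ti(2)] by (simp_all add: S_def dist_commute)
    have SV: "S \<subseteq> V" using r(2) ti(1) unfolding S_def path_image_def by blast
    have "convex S" unfolding S_def by (intro convex_Int convex_ball convex_cball)
    hence "norm (h (g (t (Suc i))) - h (g (t i))) \<le> e * norm (g (t (Suc i)) - g (t i))"
    proof (rule differentiable_bound[where f' = "\<lambda>z. blinfun_apply (D z - D0)"])
      fix z assume z: "z \<in> S"
      have "(h has_derivative (\<lambda>v. D z v - D0 v)) (at z)"
        unfolding h_def using z SV by (intro derivative_intros der blinfun.bounded_linear_right[THEN bounded_linear_imp_has_derivative]) auto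
      thus "(h has_derivative blinfun_apply (D z - D0)) (at z within S)"
        by (simp add: has_derivative_at_withinI blinfun.diff_left[abs_def])
      have "norm (D z - D0) \<le> e" using z SV by (intro e) (auto simp: S_def pathstart_def)
      thus "onorm (blinfun_apply (D z - D0)) \<le> e" by (simp add: norm_blinfun.rep_eq)
    qed (use S in auto)
    thus ?thesis by (simp add: dist_norm norm_minus_commute)
  qed
  have "\<bar>h (g (t n)) - h (g (t 0))\<bar> = \<bar>\<Sum>i<n. h (g (t (Suc i))) - h (g (t i))\<bar>"
    using sum_lessThan_telescope[of "\<lambda>i. h (g (t i))" n] by simp
  also have "\<dots> \<le> (\<Sum>i<n. e * dist (g (t i)) (g (t (Suc i))))"
    by (rule order_trans[OF sum_abs sum_mono]) (use step in auto)
  also have "\<dots> = e * (\<Sum>i<n. dist (g (t i)) (g (t (Suc i))))" by (simp add: sum_distrib_left)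
  also have "\<dots> \<le> e * len"
    by (intro mult_left_mono curve_length_sum_le[OF g(3,4)] e0) (use n in \<open>auto simp: t_def divide_right_mono\<close>)
  finally show ?thesis
    using n by (simp add: h_def t_def pathstart_def pathfinish_def blinfun.diff_right algebra_simps)
qed

lemma norm_derivative_le_lipschitz:
  fixes f :: "'a::real_normed_vector \<Rightarrow> real"
  assumes "open U" "x \<in> U" "L-lipschitz_on U f" "(f has_derivative blinfun_apply D) (at x)"
  shows "norm D \<le> L"
proof (rule norm_blinfun_bound)
  show L: "0 \<le> L" using assms(3) by (rule lipschitz_on_nonneg)
  fix v
  show "norm (D v) \<le> L * norm v"
  proof (rule field_le_epsilon)
    fix \<eta> :: real assume "\<eta> > 0"
    define e where "e = \<eta> / (norm v + 1)"
    have n1: "norm v + 1 > 0" by (simp add: add_nonneg_pos)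
    have e: "e > 0" "e * norm v \<le> \<eta>"
      using \<open>\<eta> > 0\<close> n1 by (auto simp: e_def field_simps)
    obtain r where r: "r > 0" "ball x r \<subseteq> U" using assms(1,2) by (auto simp: open_contains_ball)
    obtain d where d: "d > 0" "\<And>y. norm (y - x) < d \<Longrightarrow> norm (f y - f x - D (y - x)) \<le> e * norm (y - x)"
      using assms(4) e(1) unfolding has_derivative_at_alt by blast
    define t where "t = min r d / (norm v + 1)"
    have t: "t > 0" using r(1) d(1) n1 by (simp add: t_def)
    have "t * norm v < t * (norm v + 1)" using t by simp
    also have "\<dots> = min r d" using n1 by (simp add: t_def)
    finally have tv: "t * norm v < r" "t * norm v < d" by auto
    have "\<bar>f (x + t *\<^sub>R v) - f x - t * D v\<bar> \<le> e * (t * norm v)"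
      using d(2)[of "x + t *\<^sub>R v"] t tv by (simp add: blinfun.scaleR_right)
    moreover have "x + t *\<^sub>R v \<in> U" using r(2) tv t by (auto simp: dist_norm)
    hence "\<bar>f (x + t *\<^sub>R v) - f x\<bar> \<le> L * (t * norm v)"
      using lipschitz_onD[OF assms(3), of "x + t *\<^sub>R v" x] assms(2) t by (simp add: dist_norm)
    ultimately have "\<bar>t * D v\<bar> \<le> t * (L * norm v + e * norm v)"
      by (simp add: abs_le_iff algebra_simps)
    hence "\<bar>D v\<bar> \<le> L * norm v + e * norm v" using t by (simp add: abs_mult)
    thus "norm (D v) \<le> L * norm v + \<eta>" using e(2) by simp
  qed
qed

text \<open>The crude bounds that handle distant points and show that the modulus of the jet is bounded.\<close>

lemma jet_bounds_lipschitz: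
  fixes D :: "'a::real_normed_vector \<Rightarrow> 'a \<Rightarrow>\<^sub>L real"
  assumes lip: "L-lipschitz_on U f" and DL: "\<And>z. z \<in> U \<Longrightarrow> norm (D z) \<le> L"
    and xy: "x \<in> U" "y \<in> U"
  shows "norm (D x - D y) \<le> 2 * L" "\<bar>f y - f x - D x (y - x)\<bar> \<le> 2 * L * norm (x - y)"
proof -
  show "norm (D x - D y) \<le> 2 * L"
    using norm_triangle_ineq4[of "D x" "D y"] DL[OF xy(1)] DL[OF xy(2)] by simp
  have "\<bar>f y - f x\<bar> \<le> L * norm (x - y)"
    using lipschitz_onD[OF lip xy(2,1)] by (simp add: dist_norm norm_minus_commute)
  moreover have "\<bar>D x (y - x)\<bar> \<le> L * norm (x - y)"
    using norm_blinfun[of "D x" "y - x"] mult_right_mono[OF DL[OF xy(1)] norm_ge_zero[of "y - x"]]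
    by (simp add: norm_minus_commute)
  ultimately show "\<bar>f y - f x - D x (y - x)\<bar> \<le> 2 * L * norm (x - y)" by (simp add: abs_le_iff)
qed

text \<open>Close points lie in the same set \<open>V i\<close> because of the separation. They are joined by a curve that
stays, by quasiconvexity, so close to \<open>x\<close> that \<open>D\<close> varies by at most \<open>e / c\<close> along it. For distant points
the Lipschitz bound is absorbed in the term with \<open>M\<close>.\<close>

lemma jet_bounds:
  fixes V :: "'i \<Rightarrow> 'a::real_normed_vector set" and D :: "'a \<Rightarrow> 'a \<Rightarrow>\<^sub>L real"
  assumes c: "c \<ge> 1"
    and op: "\<And>i. i \<in> I \<Longrightarrow> open (V i)"
    and qc: "\<And>i. i \<in> I \<Longrightarrow> quasiconvex c (V i)"
    and sep: "uniformly_separated I V"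
    and der: "\<And>z. z \<in> (\<Union>i\<in>I. V i) \<Longrightarrow> (f has_derivative blinfun_apply (D z)) (at z)"
    and uc: "uniformly_continuous_on (\<Union>i\<in>I. V i) D"
    and lip: "L-lipschitz_on (\<Union>i\<in>I. V i) f"
    and e: "e > 0"
  shows "\<exists>M\<ge>0. \<forall>x\<in>\<Union>i\<in>I. V i. \<forall>y\<in>\<Union>i\<in>I. V i. norm (D x - D y) \<le> e + M * norm (x - y) \<and>
           \<bar>f y - f x - D x (y - x)\<bar> \<le> (e + M * norm (x - y)) * norm (x - y)"
proof -
  define U where "U = (\<Union>i\<in>I. V i)"
  have U: "open U" unfolding U_def using op by auto
  have L: "L \<ge> 0" using lip by (rule lipschitz_on_nonneg)
  have DL: "norm (D z) \<le> L" if "z \<in> U" for z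
    using norm_derivative_le_lipschitz[OF U that lip[folded U_def] der] that by (simp add: U_def)
  have "e / c > 0" using e c by simp
  then obtain d1 where d1: "d1 > 0" "\<And>x y. x \<in> U \<Longrightarrow> y \<in> U \<Longrightarrow> dist y x < d1 \<Longrightarrow> dist (D y) (D x) < e / c"
    using uc unfolding uniformly_continuous_on_def U_def by metis
  obtain d2 where d2: "d2 > 0"
    "\<And>i j x y. i \<in> I \<Longrightarrow> j \<in> I \<Longrightarrow> i \<noteq> j \<Longrightarrow> x \<in> V i \<Longrightarrow> y \<in> V j \<Longrightarrow> d2 \<le> dist x y"
    using sep unfolding uniformly_separated_def by blast
  define d where "d = min (d1 / c) d2"
  have d: "d > 0" using d1(1) d2(1) c by (simp add: d_def)
  define M where "M = 2 * L / d"
  have M: "M \<ge> 0" using L d by (simp add: M_def)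
  have "norm (D x - D y) \<le> e + M * norm (x - y) \<and>
      \<bar>f y - f x - D x (y - x)\<bar> \<le> (e + M * norm (x - y)) * norm (x - y)"
    if xy: "x \<in> U" "y \<in> U" for x y
  proof (cases "norm (x - y) < d")
    case True
    have ec: "e / c \<le> e" using e c by (simp add: field_simps)
    have dd: "c * dist x y < d1" using True c by (auto simp: d_def dist_norm field_simps)
    have "dist x y \<le> c * dist x y" using mult_right_mono[OF c zero_le_dist[of x y]] by simp
    hence "dist (D x) (D y) < e / c" using d1(2)[OF xy(2,1)] dd by linarith
    hence 1: "norm (D x - D y) \<le> e" using ec by (simp add: dist_norm)
    obtain i j where ij: "i \<in> I" "j \<in> I" "x \<in> V i" "y \<in> V j" using xy by (auto simp: U_def)
    have "i = j" using d2(2)[OF ij(1,2) _ ij(3,4)] True by (force simp: d_def dist_norm)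
    then obtain g where g: "path g" "path_image g \<subseteq> V i" "pathstart g = x" "pathfinish g = y"
        "curve_length g \<le> ennreal (c * dist x y)"
      using qc[OF ij(1)] ij unfolding quasiconvex_def by blast
    have "\<bar>f (pathfinish g) - f (pathstart g) - D x (pathfinish g - pathstart g)\<bar> \<le> e / c * (c * dist x y)"
    proof (rule first_order_remainder_along_curve[OF op[OF ij(1)] _ g(1,2,5)])
      fix z assume z: "z \<in> V i"
      hence zU: "z \<in> U" using ij by (auto simp: U_def)
      thus "(f has_derivative blinfun_apply (D z)) (at z)" using der by (simp add: U_def)
      assume "dist (pathstart g) z \<le> c * dist x y"
      hence "dist (D z) (D x) < e / c" using d1(2)[OF xy(1) zU] dd g(3) by (simp add: dist_commute)
      thus "norm (D z - D x) \<le> e / c" by (simp add: dist_norm)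
    qed (use c in simp)
    also have "e / c * (c * dist x y) = e * norm (x - y)" using c by (simp add: dist_norm)
    also have "e * norm (x - y) \<le> (e + M * norm (x - y)) * norm (x - y)"
      using M by (intro mult_right_mono) auto
    finally show ?thesis using 1 M g(3,4) by (simp add: add_increasing2)
  next
    case False
    have LM: "2 * L \<le> M * norm (x - y)" using False d L by (simp add: M_def field_simps mult_left_mono)
    have triv: "norm (D x - D y) \<le> 2 * L" "\<bar>f y - f x - D x (y - x)\<bar> \<le> 2 * L * norm (x - y)"
      by (rule jet_bounds_lipschitz[OF lip[folded U_def] _ xy], rule DL, assumption)+
    note triv(2)
    also have "\<dots> \<le> (e + M * norm (x - y)) * norm (x - y)"
      using LM e by (intro mult_right_mono) auto
    finally show ?thesis using triv(1) LM e by simp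
  qed
  thus ?thesis using M unfolding U_def by blast
qed

section \<open>Extension of jets\<close>

lemma gap_affine_plus:
  fixes D :: "'a::real_normed_vector \<Rightarrow>\<^sub>L real"
  shows "convexity_gap (\<lambda>x. a + D (x - y) + r * \<phi> (x - y)) l p v = r * convexity_gap \<phi> l (p - y) v"
  by (simp add: convexity_gap_def blinfun.diff_right blinfun.add_right blinfun.scaleR_right algebra_simps)

lemma gap_lipschitz_le:
  assumes "L-lipschitz_on UNIV \<phi>" "l \<in> {0..1}"
  shows "convexity_gap \<phi> l p v \<le> 2 * L * (l * (1 - l) * norm v)"
proof -
  have "\<phi> (p + (1 - l) *\<^sub>R v) - \<phi> p \<le> L * ((1 - l) * norm v)"
    using lipschitz_onD[OF assms(1), of "p + (1 - l) *\<^sub>R v" p] assms(2) by (simp add: dist_norm)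
  hence 1: "l * (\<phi> (p + (1 - l) *\<^sub>R v) - \<phi> p) \<le> l * (L * ((1 - l) * norm v))"
    using assms(2) by (intro mult_left_mono) auto
  have "\<phi> (p - l *\<^sub>R v) - \<phi> p \<le> L * (l * norm v)"
    using lipschitz_onD[OF assms(1), of "p - l *\<^sub>R v" p] assms(2) by (simp add: dist_norm)
  hence 2: "(1 - l) * (\<phi> (p - l *\<^sub>R v) - \<phi> p) \<le> (1 - l) * (L * (l * norm v))"
    using assms(2) by (intro mult_left_mono) auto
  show ?thesis using 1 2 unfolding convexity_gap_def by (simp add: algebra_simps)
qed

text \<open>An extension theorem of Whitney type. Adding the gauge to the first-order expansions of \<open>f\<close> gives upper barriers,
subtracting it gives lower barriers. The compatibility conditions place each lower barrier below
each upper one; at a point of \<open>U\<close> both touch the value of \<open>f\<close>. The infimum \<open>h\<close> of the upper barriers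
keeps their upper bound \<open>B\<close> on the gap, and every lower barrier has gap at least \<open>-B\<close>. The envelope
of \<open>h\<close> therefore lies between all barriers and has gap at most \<open>B\<close> in absolute value.\<close>

lemma jet_extension:
  fixes f N :: "'a::real_normed_vector \<Rightarrow> real" and D :: "'a \<Rightarrow> 'a \<Rightarrow>\<^sub>L real"
  assumes N: "equivalent_norm N" "uniformly_smooth N" and mod: "modulus K \<sigma>"
    and ne: "U \<noteq> {}" and DL: "\<And>x. x \<in> U \<Longrightarrow> norm (D x) \<le> L"
    and D_diff: "\<And>x y. x \<in> U \<Longrightarrow> y \<in> U \<Longrightarrow> 6 * norm (D x - D y) \<le> \<sigma> (norm (x - y))"
    and rem: "\<And>x y. x \<in> U \<Longrightarrow> y \<in> U \<Longrightarrow>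
        6 * \<bar>f y - f x - D x (y - x)\<bar> \<le> \<sigma> (norm (x - y)) * norm (x - y)"
  obtains F C where "F \<in> C1_plus UNIV" "C-lipschitz_on UNIV F" "\<And>x. x \<in> U \<Longrightarrow> F x = f x"
proof -
  obtain P and \<phi> :: "'a \<Rightarrow> real" where gauge: "smooth_gauge P \<sigma> \<phi>"
    using smooth_gauge_exists[OF N mod] by blast
  have \<phi>lip: "P-lipschitz_on UNIV \<phi>" and \<phi>0: "\<phi> 0 = 0"
    and growth: "norm w * \<sigma> (norm w) \<le> \<phi> w" for w
    using gauge by (auto simp: smooth_gauge_def)
  have \<phi>gap: "\<exists>d>0. \<forall>l\<in>{0..1}. \<forall>p v. norm v \<le> d \<longrightarrow> convexity_gap \<phi> l p v \<le> e * (l * (1 - l) * norm v)"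
    if "e > 0" for e
    using gauge that unfolding smooth_gauge_def by blast
  obtain y0 where y0: "y0 \<in> U" using ne by blast
  have \<sigma>0: "0 \<le> \<sigma> s" if "s \<ge> 0" for s using mod that by (auto simp: modulus_def)
  have mono: "\<sigma> s \<le> \<sigma> t" if "0 \<le> s" "s \<le> t" for s t
    using mod that by (auto simp: modulus_def intro: mono_onD)
  have dbl: "\<sigma> (2 * s) \<le> 2 * \<sigma> s" if "0 \<le> s" for s
  proof -
    have "\<sigma> (s + s) \<le> \<sigma> s + \<sigma> s" using mod that unfolding modulus_def by blast
    thus ?thesis by simp
  qed
  have \<phi>pos: "0 \<le> \<phi> w" for w
    by (rule order_trans[OF mult_nonneg_nonneg growth]) (auto intro: \<sigma>0)
  \<comment> \<open>upper barriers for \<open>r = 1\<close>, lower barriers for \<open>r = -1\<close>\<close>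
  define piece where "piece r y x = f y + D y (x - y) + r * \<phi> (x - y)" for r y x
  have gap_piece: "convexity_gap (piece r y) l p v = r * convexity_gap \<phi> l (p - y) v" for r y l p v
    unfolding piece_def by (rule gap_affine_plus)
  have order: "piece (-1) y x \<le> piece 1 z x" if y: "y \<in> U" and z: "z \<in> U" for x y z
  proof -
    \<comment> \<open>the hypotheses at scale \<open>n \<le> 2 m\<close> bound six times the difference of the expansions by
      \<open>3 m \<sigma> (2 m) \<le> 6 m \<sigma> m\<close>, which explains the constant \<open>6\<close>\<close>
    define m where "m = max (norm (x - y)) (norm (x - z))"
    define n where "n = norm (z - y)"
    have m: "0 \<le> m" "norm (x - y) \<le> m" by (auto simp: m_def le_max_iff_disj)
    have n: "0 \<le> n" "n \<le> 2 * m"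
      using norm_triangle_ineq4[of "x - y" "x - z"] by (auto simp: n_def m_def)
    have \<sigma>n: "0 \<le> \<sigma> n" "\<sigma> n \<le> 2 * \<sigma> m" using n m mono[of n "2 * m"] dbl[of m] \<sigma>0 by auto
    have 1: "6 * (f y - f z - D z (y - z)) \<le> \<sigma> n * (2 * m)"
    proof -
      have "6 * (f y - f z - D z (y - z)) \<le> 6 * \<bar>f y - f z - D z (y - z)\<bar>"
        by (rule mult_left_mono[OF abs_ge_self]) simp
      also have "\<dots> \<le> \<sigma> n * n" using rem[OF z y] by (simp add: n_def)
      also have "\<dots> \<le> \<sigma> n * (2 * m)" by (rule mult_left_mono[OF n(2) \<sigma>n(1)])
      finally show ?thesis .
    qed
    have "6 * (D y - D z) (x - y) \<le> 6 * (norm (D y - D z) * norm (x - y))"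
      using norm_blinfun[of "D y - D z" "x - y"] by simp
    also have "\<dots> = (6 * norm (D z - D y)) * norm (x - y)" by (simp add: norm_minus_commute)
    also have "\<dots> \<le> \<sigma> n * m"
      unfolding n_def by (intro mult_mono D_diff z y m) (use \<sigma>n m in \<open>auto simp: n_def\<close>)
    finally have 2: "6 * (D y - D z) (x - y) \<le> \<sigma> n * m" .
    have "\<sigma> n * m \<le> 2 * \<sigma> m * m" using \<sigma>n m by (intro mult_right_mono) auto
    with 1 2 have "(f y - f z - D z (y - z)) + (D y - D z) (x - y) \<le> m * \<sigma> m" by (simp add: mult_ac)
    moreover have "m * \<sigma> m \<le> \<phi> (x - y) + \<phi> (x - z)"
      using growth[of "x - y"] growth[of "x - z"] \<phi>pos[of "x - y"] \<phi>pos[of "x - z"]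
      by (cases "norm (x - y) \<le> norm (x - z)") (auto simp: m_def max_def)
    ultimately show ?thesis
      by (simp add: piece_def blinfun.diff_left blinfun.diff_right algebra_simps)
  qed
  define h where "h x = (INF y\<in>U. piece 1 y x)" for x
  have bdd: "bdd_below ((\<lambda>y. piece 1 y x) ` U)" for x
    by (rule bdd_belowI[where m = "piece (-1) y0 x"]) (auto intro: order y0)
  have h_le: "h x \<le> piece 1 y x" if "y \<in> U" for x y
    unfolding h_def by (rule cINF_lower[OF bdd that])
  have h_ge: "b \<le> h x" if "\<And>y. y \<in> U \<Longrightarrow> b \<le> piece 1 y x" for b x
    unfolding h_def by (rule cINF_greatest[OF ne that])
  have L: "0 \<le> L" using DL[OF y0] norm_ge_zero order_trans by blast
  have P: "0 \<le> P" using \<phi>lip by (rule lipschitz_on_nonneg)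
  have piece_lip: "piece 1 y x \<le> piece 1 y x' + (L + P) * norm (x - x')" if "y \<in> U" for x x' y
  proof -
    have "D y (x - y) - D y (x' - y) = D y (x - x')" by (simp add: blinfun.diff_right)
    also have "\<dots> \<le> norm (D y) * norm (x - x')" using norm_blinfun[of "D y" "x - x'"] by simp
    also have "\<dots> \<le> L * norm (x - x')" using DL[OF that] by (intro mult_right_mono) auto
    finally show ?thesis
      using lipschitz_onD[OF \<phi>lip, of "x - y" "x' - y"]
      by (simp add: piece_def dist_norm abs_le_iff algebra_simps)
  qed
  have h_diff: "h x - (L + P) * norm (x - x') \<le> h x'" for x x'
  proof (rule h_ge)
    fix y assume "y \<in> U"
    thus "h x - (L + P) * norm (x - x') \<le> piece 1 y x'"
      using h_le[of y x] piece_lip[of y x x'] by linarith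
  qed
  have h_lip: "(L + P)-lipschitz_on UNIV h"
  proof (rule lipschitz_onI)
    show "dist (h x) (h y) \<le> (L + P) * dist x y" for x y
      using h_diff[of x y] h_diff[of y x] by (simp add: dist_norm abs_le_iff norm_minus_commute)
  qed (use L P in simp)
  \<comment> \<open>the smallest translation-invariant bound for the gap of the gauge\<close>
  define B where "B l v = (SUP p. convexity_gap \<phi> l p v)" for l v
  have gap_B: "convexity_gap \<phi> l p v \<le> B l v" if "l \<in> {0..1}" for l p v
    unfolding B_def using gap_lipschitz_le[OF \<phi>lip that]
    by (intro cSUP_upper bdd_aboveI[where M = "2 * P * (l * (1 - l) * norm v)"]) auto
  have B_le: "\<exists>d>0. \<forall>l\<in>{0..1}. \<forall>v. norm v \<le> d \<longrightarrow> B l v \<le> e * (l * (1 - l) * norm v)" if e: "e > 0" for e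
  proof -
    obtain d where "d > 0" "\<And>l p v. l \<in> {0..1} \<Longrightarrow> norm v \<le> d \<Longrightarrow> convexity_gap \<phi> l p v \<le> e * (l * (1 - l) * norm v)"
      using \<phi>gap[OF e] by blast
    thus ?thesis unfolding B_def by (intro exI[of _ d]) (auto intro!: cSUP_least)
  qed
  have h_gap: "convexity_gap h l p v \<le> B l v" if l: "l \<in> {0..1}" for l p v
  proof -
    have "l * h (p + (1 - l) *\<^sub>R v) + (1 - l) * h (p - l *\<^sub>R v) - B l v \<le> h p"
    proof (rule h_ge)
      fix y assume y: "y \<in> U"
      have "l * h (p + (1 - l) *\<^sub>R v) \<le> l * piece 1 y (p + (1 - l) *\<^sub>R v)"
        "(1 - l) * h (p - l *\<^sub>R v) \<le> (1 - l) * piece 1 y (p - l *\<^sub>R v)"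
        using l h_le[OF y] by (auto intro!: mult_left_mono)
      moreover have "convexity_gap (piece 1 y) l p v \<le> B l v" using gap_B[OF l] by (simp add: gap_piece)
      ultimately show "l * h (p + (1 - l) *\<^sub>R v) + (1 - l) * h (p - l *\<^sub>R v) - B l v \<le> piece 1 y p"
        by (simp add: convexity_gap_def)
    qed
    thus ?thesis by (simp add: convexity_gap_def)
  qed
  have low_gap: "- B l v \<le> convexity_gap (piece (-1) y) l p v" if "l \<in> {0..1}" for l p v y
    using gap_B[OF that] by (simp add: gap_piece)
  have low_h: "piece (-1) y x \<le> h x" if "y \<in> U" for x y
    by (rule h_ge) (rule order[OF that])
  obtain F where F: "(L + P)-lipschitz_on UNIV F" "\<And>x. F x \<le> h x"
    "\<And>l p v. l \<in> {0..1} \<Longrightarrow> \<bar>convexity_gap F l p v\<bar> \<le> B l v"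
    "\<And>g x. (\<And>x. g x \<le> h x) \<Longrightarrow> (\<And>l p v. l \<in> {0..1} \<Longrightarrow> - B l v \<le> convexity_gap g l p v) \<Longrightarrow> g x \<le> F x"
    using envelope_between[OF h_lip h_gap low_h[OF y0] low_gap] by metis
  have "F \<in> C1_plus UNIV"
  proof (rule C1_plus_if_gap_small[OF F(1)])
    fix e :: real assume "e > 0"
    then obtain d where d: "d > 0" "\<forall>l\<in>{0..1}. \<forall>v. norm v \<le> d \<longrightarrow> B l v \<le> e * (l * (1 - l) * norm v)"
      using B_le by blast
    hence "\<bar>convexity_gap F l p v\<bar> \<le> e * (l * (1 - l) * norm v)" if "l \<in> {0..1}" "norm v \<le> d" for l p v
      using F(3)[OF that(1), of p v] that by (meson order_trans)
    thus "\<exists>d>0. \<forall>l\<in>{0..1}. \<forall>p v. norm v \<le> d \<longrightarrow> \<bar>convexity_gap F l p v\<bar> \<le> e * (l * (1 - l) * norm v)"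
      using d(1) by blast
  qed
  moreover have "F x = f x" if x: "x \<in> U" for x
  proof (rule antisym)
    show "F x \<le> f x" using F(2)[of x] h_le[OF x, of x] by (simp add: piece_def \<phi>0)
    have "piece (-1) x x \<le> F x" by (rule F(4)) (auto intro: low_h[OF x] low_gap)
    thus "f x \<le> F x" by (simp add: piece_def \<phi>0)
  qed
  ultimately show thesis using that F(1) by blast
qed

theorem corollary56:
  fixes c :: real and I :: "'i set" and V :: "'i \<Rightarrow> 'a::banach set"
    and U :: "'a set" and f :: "'a \<Rightarrow> real"
  assumes "super_reflexive TYPE('a)"
    and "c \<ge> 1"
    and "\<And>i. i \<in> I \<Longrightarrow> open (V i)"
    and "\<And>i. i \<in> I \<Longrightarrow> quasiconvex c (V i)"
    and "uniformly_separated I V"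
    and "U = (\<Union>i\<in>I. V i)"
    and "f \<in> C1_plus U"
    and "\<exists>L. L-lipschitz_on U f"
  shows "\<exists>F. F \<in> C1_plus UNIV \<and> (\<exists>L. L-lipschitz_on UNIV F) \<and> (\<forall>x\<in>U. F x = f x)"
proof (cases "U = {}")
  case True
  have "(\<lambda>_. 0) \<in> C1_plus (UNIV :: 'a set)"
    unfolding C1_plus_def
    by (auto intro!: exI[of _ "\<lambda>_. 0"] uniformly_continuous_on_const simp: zero_blinfun.rep_eq)
  moreover have "0-lipschitz_on UNIV (\<lambda>_::'a. 0::real)" by (rule lipschitz_onI) auto
  ultimately show ?thesis using True by blast
next
  case False
  have U: "open U" using assms(3,6) by auto
  obtain N :: "'a \<Rightarrow> real" where N: "equivalent_norm N" "uniformly_smooth N"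
    using assms(1) unfolding super_reflexive_def by blast
  obtain D :: "'a \<Rightarrow> 'a \<Rightarrow>\<^sub>L real" where
    D: "\<And>x. x \<in> U \<Longrightarrow> (f has_derivative blinfun_apply (D x)) (at x within U)"
    and uc: "uniformly_continuous_on U D"
    using assms(7) unfolding C1_plus_def by blast
  have der: "(f has_derivative blinfun_apply (D x)) (at x)" if "x \<in> U" for x
    using D[OF that] at_within_open[OF that U] by simp
  obtain L where L: "L-lipschitz_on U f" using assms(8) by blast
  have DL: "norm (D x) \<le> L" if "x \<in> U" for x
    by (rule norm_derivative_le_lipschitz[OF U that L der[OF that]])
  \<comment> \<open>all affine bounds for the jet, with the factor \<open>6\<close> built in\<close>
  define A where "A = {(e, M). 0 \<le> e \<and> 0 \<le> M \<and> (\<forall>x\<in>U. \<forall>y\<in>U.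
      6 * norm (D x - D y) \<le> e + M * norm (x - y) \<and>
      6 * \<bar>f y - f x - D x (y - x)\<bar> \<le> (e + M * norm (x - y)) * norm (x - y))}"
  define \<sigma> where "\<sigma> s = (INF (e, M)\<in>A. e + M * s)" for s
  have K: "(12 * L, 0) \<in> A"
    using jet_bounds_lipschitz[OF L DL] lipschitz_on_nonneg[OF L] by (force simp: A_def)
  have "modulus (12 * L) (\<lambda>s. INF (e, M)\<in>A. e + M * s)"
  proof (rule modulus_Inf_affine[OF _ K])
    fix e :: real assume "e > 0"
    hence "e / 6 > 0" by simp
    have "\<exists>M\<ge>0. \<forall>x\<in>U. \<forall>y\<in>U. norm (D x - D y) \<le> e / 6 + M * norm (x - y) \<and>
        \<bar>f y - f x - D x (y - x)\<bar> \<le> (e / 6 + M * norm (x - y)) * norm (x - y)"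
      unfolding assms(6)
      by (rule jet_bounds[OF assms(2,3,4,5) der[unfolded assms(6)] uc[unfolded assms(6)]
            L[unfolded assms(6)] \<open>e / 6 > 0\<close>])
    then obtain M where M: "M \<ge> 0"
      "\<forall>x\<in>U. \<forall>y\<in>U. norm (D x - D y) \<le> e / 6 + M * norm (x - y) \<and>
        \<bar>f y - f x - D x (y - x)\<bar> \<le> (e / 6 + M * norm (x - y)) * norm (x - y)"
      by (elim exE conjE)
    have "6 * norm (D x - D y) \<le> e + 6 * M * norm (x - y) \<and>
        6 * \<bar>f y - f x - D x (y - x)\<bar> \<le> (e + 6 * M * norm (x - y)) * norm (x - y)"
      if "x \<in> U" "y \<in> U" for x y
    proof -
      have "(e + 6 * M * norm (x - y)) * norm (x - y) = 6 * ((e / 6 + M * norm (x - y)) * norm (x - y))"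
        by (simp add: algebra_simps)
      thus ?thesis using M(2)[rule_format, OF that] by (simp only:) simp
    qed
    hence "(e, 6 * M) \<in> A" using M(1) \<open>e > 0\<close> by (simp add: A_def)
    thus "\<exists>M. (e, M) \<in> A" by blast
  qed (simp add: A_def)
  hence mod: "modulus (12 * L) \<sigma>" by (simp add: \<sigma>_def[abs_def])
  have ge: "b \<le> \<sigma> s" if "\<And>e M. (e, M) \<in> A \<Longrightarrow> b \<le> e + M * s" for b s
    unfolding \<sigma>_def by (rule cINF_greatest) (use that K in auto)
  have D_diff: "6 * norm (D x - D y) \<le> \<sigma> (norm (x - y))" if "x \<in> U" "y \<in> U" for x y
    by (rule ge) (use that in \<open>auto simp: A_def\<close>)
  have rem: "6 * \<bar>f y - f x - D x (y - x)\<bar> \<le> \<sigma> (norm (x - y)) * norm (x - y)"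
    if "x \<in> U" "y \<in> U" for x y
  proof (cases "x = y")
    case False
    hence n: "norm (x - y) > 0" by simp
    have "6 * \<bar>f y - f x - D x (y - x)\<bar> / norm (x - y) \<le> \<sigma> (norm (x - y))"
      by (rule ge) (use that n in \<open>auto simp: A_def pos_divide_le_eq\<close>)
    thus ?thesis using n by (simp add: pos_divide_le_eq)
  qed simp
  obtain F C where "F \<in> C1_plus UNIV" "C-lipschitz_on UNIV F" "\<And>x. x \<in> U \<Longrightarrow> F x = f x"
    using jet_extension[OF N mod False DL D_diff rem] by metis
  thus ?thesis by blast
qed

end
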